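(* Let $p\ge 2$, $\gamma>0$, and let $\mu$ be an Ising model on $\{-1,1\}^p$ with $\ell_1$-width at most $\gamma$. Let $0<\epsilon\le 4\gamma$ and $\delta\in(0,1)$. Set \[ d=\left\lceil \frac{3\gamma+\log\!\big(\tfrac{16\gamma(1+\gamma)}{\epsilon^2}\big)}{W\!\Big(\tfrac{3}{e}+\tfrac{1}{\gamma e}\log\!\big(\tfrac{16\gamma(1+\gamma)}{\epsilon^2}\big)\Big)}\right\rceil-1, \qquad T=\left\lceil\frac{576\,p\,\gamma^2e^{8\gamma}(1+\gamma)^2}{\epsilon^4}\right\rceil,\qquad \eta=\frac{2\gamma e^{-\gamma}}{3\sqrt{pT}}, \] \[ n=\left\lceil 2^7e^{8\gamma}\gamma^2(1+\gamma)^2\,\frac{(d+2)\log(ep)+\log\!\big(\tfrac{2p(d+2)}{\delta}\big)}{\epsilon^4}\right\rceil , \] where $W$ is the principal branch of the Lambert $W$ function, and assume $d+2\le p$. Suppose Algorithm 1 is run with these parameters and with moment estimates of order $d+2-(d\bmod 2)$ from $n$ observations. Then for each $u\in[p]$, with probability at least $1-\delta$, its output satisfies \[ \max_{v\ne u}|\hat\theta_{u,v}-\theta^*_{u,v}|\le\epsilon . \]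
   Context: Ising model: for $p\ge2$, a distribution on $\{-1,1\}^p$ of the form $\mu(\underline\sigma)\propto\exp\big(\sum_{\{u,v\}}\theta^*_{u,v}\sigma_u\sigma_v+\sum_{u\in[p]}\theta^*_u\sigma_u\big)$, where the first sum runs over unordered pairs of distinct indices and the couplings are symmetric, $\theta^*_{u,v}=\theta^*_{v,u}$. It has $\ell_1$-width at most $\gamma$ if $\sum_{v\ne u}|\theta^*_{u,v}|+|\theta^*_u|\le\gamma$ for every $u\in[p]$. For a node $u$, the local parameter vector is $\underline\theta_u=(\theta_u,(\theta_{u,v})_{v\ne u})\in\mathbb R^p$ (true value $\underline\theta^*_u=(\theta^*_u,(\theta^*_{u,v})_{v\ne u})$), and the local energy is $E_u(\underline\sigma;\underline\theta_u)=\sigma_u\big(\theta_u+\sum_{v\ne u}\theta_{u,v}\sigma_v\big)$. Moment estimates: for $K\subseteq[p]$ let $\sigma_K=\prod_{i\in K}\sigma_i$ ($\sigma_\emptyset=1$). Moment estimates of order $m$ from $n$ observations are numbers $\{\hat m_K:K\subseteq[p],|K|\le m\}$, each $\hat m_K$ being the empirical average of $\sigma_K$ over $n$ i.i.d. samples from $\mu$ (different sets $K$ may use different samples). For a polynomial $q$ in $\sigma_1,\dots,\sigma_p$ whose multilinear reduction (using $\sigma_i^2=1$) is $\sum_K c_K\sigma_K$ with all $|K|\le m$, set $\hat{\mathbb E}[q]=\sum_K c_K\hat m_K$. $P_d(x)=\sum_{k=0}^d\frac{(-x)^k}{k!}$. Algorithm 1: input $d,\gamma,\eta,T$ and moment estimates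 of order $d+2-(d\bmod 2)$. For each $u\in[p]$, define the approximate gradient $\tilde g(\underline\theta_u)\in\mathbb R^p$ by $\tilde g_u(\underline\theta_u)=-\hat{\mathbb E}[\sigma_uP_d(E_u(\underline\sigma;\underline\theta_u))]$ (coordinate of $\theta_u$) and $\tilde g_v(\underline\theta_u)=-\hat{\mathbb E}[\sigma_u\sigma_vP_d(E_u(\underline\sigma;\underline\theta_u))]$ for $v\ne u$ (coordinate of $\theta_{u,v}$); all multilinear monomials arising have at most $d+2-(d\bmod2)$ variables. Starting from $\underline\theta^{(1)}=0$, iterate $\underline\theta^{(t+1)}=\Pi\big(\underline\theta^{(t)}-\eta\,\tilde g(\underline\theta^{(t)})\big)$ for $t=1,\dots,T$, where $\Pi$ is the Euclidean projection onto $\{x\in\mathbb R^p:\|x\|_1\le\gamma\}$, and output $\hat{\underline\theta}_u=\frac1T\sum_{t=1}^T\underline\theta^{(t)}$, whose coordinates are denoted $(\hat\theta_u,(\hat\theta_{u,v})_{v\ne u})$. *)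

theory Defs
  imports "HOL-Probability.Probability"
begin

text \<open>Spin configurations on [p] = {0..<p}, represented as functions nat => real
  with values +-1 on indices < p and the (irrelevant) value 1 elsewhere.\<close>
definition cube :: "nat \<Rightarrow> (nat \<Rightarrow> real) set" where
  "cube p = {\<sigma>. (\<forall>i<p. \<sigma> i = 1 \<or> \<sigma> i = -1) \<and> (\<forall>i. p \<le> i \<longrightarrow> \<sigma> i = 1)}"

definition sigK :: "(nat \<Rightarrow> real) \<Rightarrow> nat set \<Rightarrow> real" where
  "sigK \<sigma> K = (\<Prod>i\<in>K. \<sigma> i)"

definition ising_energy :: "nat \<Rightarrow> (nat \<Rightarrow> nat \<Rightarrow> real) \<Rightarrow> (nat \<Rightarrow> real) \<Rightarrow> (nat \<Rightarrow> real) \<Rightarrow> real" where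
  "ising_energy p th h \<sigma> =
     (\<Sum>u<p. \<Sum>v\<in>{u<..<p}. th u v * \<sigma> u * \<sigma> v) + (\<Sum>u<p. h u * \<sigma> u)"

definition ising_prob :: "nat \<Rightarrow> (nat \<Rightarrow> nat \<Rightarrow> real) \<Rightarrow> (nat \<Rightarrow> real) \<Rightarrow> (nat \<Rightarrow> real) \<Rightarrow> real" where
  "ising_prob p th h \<sigma> =
     (if \<sigma> \<in> cube p
      then exp (ising_energy p th h \<sigma>) / (\<Sum>\<tau>\<in>cube p. exp (ising_energy p th h \<tau>))
      else 0)"

definition l1_width_le :: "nat \<Rightarrow> (nat \<Rightarrow> nat \<Rightarrow> real) \<Rightarrow> (nat \<Rightarrow> real) \<Rightarrow> real \<Rightarrow> bool" where
  "l1_width_le p th h \<gamma> \<longleftrightarrow> (\<forall>u<p. (\<Sum>v\<in>{..<p} - {u}. \<bar>th u v\<bar>) + \<bar>h u\<bar> \<le> \<gamma>)"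

text \<open>Multilinear reduction: the coefficient of sigma_K in the unique multilinear polynomial
  agreeing with q on {-1,1}^p (Fourier--Walsh coefficient).\<close>
definition ml_coeff :: "nat \<Rightarrow> ((nat \<Rightarrow> real) \<Rightarrow> real) \<Rightarrow> nat set \<Rightarrow> real" where
  "ml_coeff p q K = (\<Sum>\<sigma>\<in>cube p. q \<sigma> * sigK \<sigma> K) / 2 ^ p"

definition hatE :: "nat \<Rightarrow> (nat set \<Rightarrow> real) \<Rightarrow> ((nat \<Rightarrow> real) \<Rightarrow> real) \<Rightarrow> real" where
  "hatE p mhat q = (\<Sum>K\<in>Pow {..<p}. ml_coeff p q K * mhat K)"

definition Pd :: "nat \<Rightarrow> real \<Rightarrow> real" where
  "Pd d x = (\<Sum>k\<le>d. (- x) ^ k / fact k)"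

text \<open>Local parameter vector: coordinate u is theta_u, coordinate v (v ~= u) is theta_{u,v}.\<close>
definition local_energy :: "nat \<Rightarrow> nat \<Rightarrow> (nat \<Rightarrow> real) \<Rightarrow> (nat \<Rightarrow> real) \<Rightarrow> real" where
  "local_energy p u \<sigma> th = \<sigma> u * (th u + (\<Sum>v\<in>{..<p} - {u}. th v * \<sigma> v))"

definition approx_grad :: "nat \<Rightarrow> nat \<Rightarrow> (nat set \<Rightarrow> real) \<Rightarrow> nat \<Rightarrow> (nat \<Rightarrow> real) \<Rightarrow> nat \<Rightarrow> real" where
  "approx_grad p d mhat u th w =
     (if w < p then
        - hatE p mhat (\<lambda>\<sigma>. \<sigma> u * (if w = u then 1 else \<sigma> w) * Pd d (local_energy p u \<sigma> th))
      else 0)"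

definition l1ball :: "nat \<Rightarrow> real \<Rightarrow> (nat \<Rightarrow> real) set" where
  "l1ball p \<gamma> = {x. (\<forall>i. p \<le> i \<longrightarrow> x i = 0) \<and> (\<Sum>i<p. \<bar>x i\<bar>) \<le> \<gamma>}"

definition proj_l1 :: "nat \<Rightarrow> real \<Rightarrow> (nat \<Rightarrow> real) \<Rightarrow> (nat \<Rightarrow> real)" where
  "proj_l1 p \<gamma> x = (THE y. y \<in> l1ball p \<gamma> \<and>
      (\<forall>z\<in>l1ball p \<gamma>. (\<Sum>i<p. (x i - y i)\<^sup>2) \<le> (\<Sum>i<p. (x i - z i)\<^sup>2)))"

text \<open>alg_iter ... t is theta^(t+1) of Algorithm 1.\<close>
primrec alg_iter :: "nat \<Rightarrow> nat \<Rightarrow> real \<Rightarrow> real \<Rightarrow> (nat set \<Rightarrow> real) \<Rightarrow> nat \<Rightarrow> nat \<Rightarrow> (nat \<Rightarrow> real)" where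
  "alg_iter p d \<gamma> \<eta> mhat u 0 = (\<lambda>_. 0)"
| "alg_iter p d \<gamma> \<eta> mhat u (Suc t) =
     (let th = alg_iter p d \<gamma> \<eta> mhat u t
      in proj_l1 p \<gamma> (\<lambda>i. th i - \<eta> * approx_grad p d mhat u th i))"

definition algorithm1 :: "nat \<Rightarrow> nat \<Rightarrow> real \<Rightarrow> real \<Rightarrow> nat \<Rightarrow> (nat set \<Rightarrow> real) \<Rightarrow> nat \<Rightarrow> (nat \<Rightarrow> real)" where
  "algorithm1 p d \<gamma> \<eta> T mhat u = (\<lambda>i. (\<Sum>t<T. alg_iter p d \<gamma> \<eta> mhat u t i) / real T)"

text \<open>Principal branch of the Lambert W function (on [-1/e, oo)).\<close>
definition lambertW :: "real \<Rightarrow> real" where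
  "lambertW x = (THE y. -1 \<le> y \<and> y * exp y = x)"

end

theory Submission
  imports Defs
begin

text \<open>
  Let \<open>S(x) = E exp (- E_u(\<sigma>; x))\<close> be the interaction screening objective. Flipping \<open>\<sigma> u\<close> leaves
  \<open>\<mu>(\<sigma>) exp (- E_u(\<sigma>; \<theta>*))\<close> invariant, so the convex function \<open>S\<close> is stationary at \<open>\<theta>*\<close>, and
  \<open>exp (- x) - 1 + x \<ge> x\<^sup>2 / (2 + \<bar>x\<bar>)\<close> together with a lower bound on second moments of linear forms
  in the spins gives \<open>S(x) - S(\<theta>*) \<ge> exp (- 3\<gamma>) (x v - \<theta>* v)\<^sup>2 / (2 (1 + \<gamma>))\<close> on the \<open>\<ell>\<^sub>1\<close>-ball.
  Projected gradient descent makes the excess of \<open>S\<close> at the averaged iterate at most the usual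
  regret bound, here at most \<open>exp (- 3\<gamma>) \<epsilon>\<^sup>2 / (16 (1 + \<gamma>))\<close>, plus \<open>2\<gamma>\<close> times the gradient
  error in the supremum norm. This error has two parts. Truncating the exponential series costs at most
  \<open>exp (- 3\<gamma>) \<epsilon>\<^sup>2 / (16 \<gamma> (1 + \<gamma>))\<close>, which is what the Lambert function in the choice of \<open>d\<close>
  encodes. The absolute Fourier--Walsh coefficients of \<open>\<sigma> u \<sigma> v P_d(E_u)\<close> sum to at most \<open>exp \<gamma>\<close>,
  so the sampling error is at most \<open>exp \<gamma>\<close> times the largest moment deviation, which is
  controlled by Hoeffding's inequality and a union bound.
\<close>

subsection \<open>Fourier--Walsh expansion on the cube\<close>

text \<open>A configuration is determined by its set of minus spins. This encoding gives the cube
  its finiteness and its size \<open>2 ^ p\<close>.\<close>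

definition spin_of_set :: "nat \<Rightarrow> nat set \<Rightarrow> nat \<Rightarrow> real" where
  "spin_of_set p A = (\<lambda>i. if i < p \<and> i \<in> A then -1 else 1)"

lemma bij_betw_spin_of_set: "bij_betw (spin_of_set p) (Pow {..<p}) (cube p)"
proof (rule bij_betw_byWitness[where f' = "\<lambda>\<sigma>. {i. i < p \<and> \<sigma> i = -1}"])
  show "\<forall>\<sigma>\<in>cube p. spin_of_set p {i. i < p \<and> \<sigma> i = -1} = \<sigma>"
    by (auto simp: spin_of_set_def cube_def fun_eq_iff) (metis not_le)
qed (auto simp: spin_of_set_def cube_def)

lemma finite_cube [simp, intro]: "finite (cube p)"
  using bij_betw_finite[OF bij_betw_spin_of_set] by simp

lemma card_cube: "card (cube p) = 2 ^ p"
  using bij_betw_same_card[OF bij_betw_spin_of_set[of p]] by (simp add: card_Pow)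

lemma cube_ne: "cube p \<noteq> {}"
  using card_cube[of p] by auto

definition flip :: "nat \<Rightarrow> (nat \<Rightarrow> real) \<Rightarrow> nat \<Rightarrow> real" where
  "flip i \<sigma> = \<sigma>(i := - \<sigma> i)"

lemma flip_simps [simp]: "flip i \<sigma> i = - \<sigma> i" "j \<noteq> i \<Longrightarrow> flip i \<sigma> j = \<sigma> j"
  by (auto simp: flip_def)

lemma flip_flip [simp]: "flip i (flip i \<sigma>) = \<sigma>"
  by (auto simp: flip_def)

lemma flip_in_cube [intro]: "i < p \<Longrightarrow> \<sigma> \<in> cube p \<Longrightarrow> flip i \<sigma> \<in> cube p"
  by (auto simp: flip_def cube_def)

lemma sum_cube_flip:
  assumes "i < p"
  shows "(\<Sum>\<sigma>\<in>cube p. f (flip i \<sigma>)) = (\<Sum>\<sigma>\<in>cube p. f \<sigma>)"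
  by (rule sum.reindex_bij_witness[where i = "flip i" and j = "flip i"]) (use assms in auto)

text \<open>A flip permutes the cube, so the sum equals its own negative. This serves both the
  orthogonality of the characters \<open>sigK\<close> and the stationarity of the screening
  objective.\<close>

lemma sum_cube_odd:
  fixes f :: "(nat \<Rightarrow> real) \<Rightarrow> real"
  assumes "i < p" and "\<And>\<sigma>. \<sigma> \<in> cube p \<Longrightarrow> f (flip i \<sigma>) = - f \<sigma>"
  shows "(\<Sum>\<sigma>\<in>cube p. f \<sigma>) = 0"
proof -
  have "(\<Sum>\<sigma>\<in>cube p. f \<sigma>) = (\<Sum>\<sigma>\<in>cube p. - f \<sigma>)"
    by (subst sum_cube_flip[OF assms(1), symmetric]) (simp add: assms(2))
  thus ?thesis by (simp add: sum_negf)
qed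

lemma cube_square: "\<sigma> \<in> cube p \<Longrightarrow> \<sigma> i * \<sigma> i = 1"
  by (cases "i < p") (auto simp: cube_def)

lemma cube_abs: "\<sigma> \<in> cube p \<Longrightarrow> \<bar>\<sigma> i\<bar> = 1"
  by (cases "i < p") (auto simp: cube_def)

lemma abs_sigK: "\<sigma> \<in> cube p \<Longrightarrow> \<bar>sigK \<sigma> K\<bar> = 1"
  by (simp add: sigK_def abs_prod cube_abs)

lemma sigK_empty [simp]: "sigK \<sigma> {} = 1"
  by (simp add: sigK_def)

lemma sigK_insert: "finite K \<Longrightarrow> i \<notin> K \<Longrightarrow> sigK \<sigma> (insert i K) = \<sigma> i * sigK \<sigma> K"
  by (simp add: sigK_def)

text \<open>Symmetric difference with \<open>{i}\<close>: the effect on a monomial of multiplying by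
  \<open>\<sigma> i\<close> and reducing by \<open>\<sigma> i * \<sigma> i = 1\<close>.\<close>

definition toggle :: "nat \<Rightarrow> nat set \<Rightarrow> nat set" where
  "toggle i K = (if i \<in> K then K - {i} else insert i K)"

lemma toggle_subset: "i \<in> A \<Longrightarrow> K \<subseteq> A \<Longrightarrow> toggle i K \<subseteq> A"
  by (auto simp: toggle_def)

lemma finite_toggle [simp]: "finite (toggle i K) \<longleftrightarrow> finite K"
  by (auto simp: toggle_def)

lemma card_toggle_le: "finite K \<Longrightarrow> card (toggle i K) \<le> Suc (card K)"
  by (auto simp: toggle_def card_insert_if card_Diff_singleton le_SucI)

lemma sigK_toggle:
  assumes "\<sigma> \<in> cube p" "finite K"
  shows "sigK \<sigma> (toggle i K) = \<sigma> i * sigK \<sigma> K"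
proof (cases "i \<in> K")
  case True
  then have "sigK \<sigma> K = \<sigma> i * sigK \<sigma> (K - {i})"
    using assms(2) by (simp add: sigK_def prod.remove)
  then show ?thesis
    using True cube_square[OF assms(1), of i] by (simp add: toggle_def flip: mult.assoc)
qed (use assms in \<open>simp add: toggle_def sigK_insert\<close>)

lemma sigK_flip:
  assumes "finite K"
  shows "sigK (flip i \<sigma>) K = (if i \<in> K then - sigK \<sigma> K else sigK \<sigma> K)"
proof (cases "i \<in> K")
  case True
  have "sigK (flip i \<sigma>) (K - {i}) = sigK \<sigma> (K - {i})"
    unfolding sigK_def by (rule prod.cong) auto
  with True assms show ?thesis
    by (simp add: sigK_def prod.remove)
next
  case False
  then show ?thesis
    unfolding sigK_def by (auto intro!: prod.cong) (metis flip_simps(2))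
qed

text \<open>For distinct sets, the product is odd under the flip at any index that lies in exactly
  one of them.\<close>

lemma sum_cube_sigK_mult:
  assumes "K \<subseteq> {..<p}" "L \<subseteq> {..<p}"
  shows "(\<Sum>\<sigma>\<in>cube p. sigK \<sigma> L * sigK \<sigma> K) = (if K = L then 2 ^ p else 0)"
proof (cases "K = L")
  case True
  have "sigK \<sigma> L * sigK \<sigma> L = 1" if "\<sigma> \<in> cube p" for \<sigma>
    using abs_sigK[OF that, of L] by (metis abs_mult_self_eq mult_1)
  with True show ?thesis by (simp add: card_cube)
next
  case False
  have fin: "finite K" "finite L" using assms finite_subset by blast+
  from False obtain i where i: "i \<in> K \<longleftrightarrow> i \<notin> L" by blast
  then have "i < p" using assms by auto
  then have "(\<Sum>\<sigma>\<in>cube p. sigK \<sigma> L * sigK \<sigma> K) = 0"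
    by (rule sum_cube_odd) (use i fin in \<open>auto simp: sigK_flip\<close>)
  with False show ?thesis by simp
qed

text \<open>The sum over all subsets factors over the sites, and a site where the configurations
  differ contributes the factor \<open>-1 + 1\<close>.\<close>

lemma sum_Pow_sigK_mult:
  assumes "\<sigma> \<in> cube p" "\<tau> \<in> cube p"
  shows "(\<Sum>K\<in>Pow {..<p}. sigK \<sigma> K * sigK \<tau> K) = (if \<sigma> = \<tau> then 2 ^ p else 0)"
proof -
  have "(\<Sum>K\<in>Pow {..<p}. sigK \<sigma> K * sigK \<tau> K) = (\<Prod>i<p. \<sigma> i * \<tau> i + 1)"
    by (subst prod_add) (simp_all add: sigK_def prod.distrib)
  also have "\<dots> = (if \<sigma> = \<tau> then 2 ^ p else 0)"
  proof (cases "\<sigma> = \<tau>")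
    case True
    then show ?thesis using cube_square[OF assms(1)] by simp
  next
    case False
    then obtain i where "\<sigma> i \<noteq> \<tau> i" by blast
    with assms have "i < p" "\<sigma> i * \<tau> i + 1 = 0"
      by (cases "i < p"; force simp: cube_def)+
    then have "(\<Prod>i<p. \<sigma> i * \<tau> i + 1) = 0" by (intro prod_zero) auto
    with False show ?thesis by simp
  qed
  finally show ?thesis .
qed

section \<open>Linearity of the moment functional and its value at exact moments\<close>

lemma hatE_cong:
  "(\<And>\<sigma>. \<sigma> \<in> cube p \<Longrightarrow> q \<sigma> = q' \<sigma>) \<Longrightarrow> hatE p f q = hatE p f q'"
  by (simp add: hatE_def ml_coeff_def cong: sum.cong)

lemma hatE_cmult: "hatE p f (\<lambda>\<sigma>. c * q \<sigma>) = c * hatE p f q"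
  by (simp add: hatE_def ml_coeff_def sum_distrib_left mult_ac)

lemma hatE_sum: "hatE p f (\<lambda>\<sigma>. \<Sum>a\<in>A. q a \<sigma>) = (\<Sum>a\<in>A. hatE p f (q a))"
proof -
  have "hatE p f (\<lambda>\<sigma>. \<Sum>a\<in>A. q a \<sigma>) =
      (\<Sum>K\<in>Pow {..<p}. \<Sum>a\<in>A. ml_coeff p (q a) K * f K)"
    unfolding hatE_def ml_coeff_def
    by (simp add: sum_distrib_right sum_divide_distrib sum.swap[of _ "cube p" A])
  then show ?thesis by (simp add: hatE_def sum.swap[of _ "Pow {..<p}" A])
qed

lemma hatE_diff: "hatE p (\<lambda>K. f K - g K) q = hatE p f q - hatE p g q"
  by (simp add: hatE_def algebra_simps sum_subtractf)

lemma hatE_sigK: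
  assumes "L \<subseteq> {..<p}"
  shows "hatE p f (\<lambda>\<sigma>. sigK \<sigma> L) = f L"
proof -
  have "hatE p f (\<lambda>\<sigma>. sigK \<sigma> L) = (\<Sum>K\<in>Pow {..<p}. if K = L then f K else 0)"
    unfolding hatE_def ml_coeff_def
    by (intro sum.cong refl) (use assms in \<open>auto simp: sum_cube_sigK_mult\<close>)
  with assms show ?thesis by simp
qed

text \<open>Dual orthogonality collapses the double sum over configurations. As \<open>hatE\<close>
  is linear in the moments, the sampling error of a gradient coordinate is therefore
  \<open>hatE\<close> applied to the moment deviations.\<close>

lemma hatE_expectation:
  "hatE p (\<lambda>K. \<Sum>\<sigma>\<in>cube p. \<mu> \<sigma> * sigK \<sigma> K) q = (\<Sum>\<sigma>\<in>cube p. \<mu> \<sigma> * q \<sigma>)"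
proof -
  have "hatE p (\<lambda>K. \<Sum>\<sigma>\<in>cube p. \<mu> \<sigma> * sigK \<sigma> K) q =
      (\<Sum>K\<in>Pow {..<p}. \<Sum>\<sigma>\<in>cube p. \<Sum>\<tau>\<in>cube p.
         \<mu> \<sigma> * q \<tau> / 2 ^ p * (sigK \<sigma> K * sigK \<tau> K))"
    unfolding hatE_def ml_coeff_def
    by (intro sum.cong refl, subst mult.commute)
       (simp only: sum_divide_distrib sum_product, simp add: mult_ac)
  also have "\<dots> = (\<Sum>\<sigma>\<in>cube p. \<Sum>\<tau>\<in>cube p. \<Sum>K\<in>Pow {..<p}.
         \<mu> \<sigma> * q \<tau> / 2 ^ p * (sigK \<sigma> K * sigK \<tau> K))"
    by (simp add: sum.swap[of _ "cube p" "Pow {..<p}"])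
  also have "\<dots> = (\<Sum>\<sigma>\<in>cube p. \<Sum>\<tau>\<in>cube p. if \<sigma> = \<tau> then \<mu> \<sigma> * q \<tau> else 0)"
    by (intro sum.cong refl) (simp only: sum_distrib_left[symmetric], simp add: sum_Pow_sigK_mult)
  also have "\<dots> = (\<Sum>\<sigma>\<in>cube p. \<mu> \<sigma> * q \<sigma>)"
    by simp
  finally show ?thesis .
qed

text \<open>The factor that multiplies coordinate \<open>v\<close> of a local parameter vector. The
  field is stored at index \<open>u\<close> and gets the constant factor 1, so one sum over
  \<open>v < p\<close> covers field and couplings.\<close>

definition others :: "nat \<Rightarrow> (nat \<Rightarrow> real) \<Rightarrow> nat \<Rightarrow> real" where
  "others u \<sigma> v = (if v = u then 1 else \<sigma> v)"

lemma local_energy_others: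
  assumes "u < p"
  shows "local_energy p u \<sigma> th = \<sigma> u * (\<Sum>v<p. th v * others u \<sigma> v)"
proof -
  have "(\<Sum>v<p. th v * others u \<sigma> v) = th u + (\<Sum>v\<in>{..<p} - {u}. th v * others u \<sigma> v)"
    using assms by (simp add: sum.remove[of _ u] others_def)
  also have "(\<Sum>v\<in>{..<p} - {u}. th v * others u \<sigma> v) = (\<Sum>v\<in>{..<p} - {u}. th v * \<sigma> v)"
    by (intro sum.cong) (auto simp: others_def)
  finally show ?thesis by (simp add: local_energy_def)
qed

text \<open>Expanding one factor of the power toggles at most one index of \<open>L\<close> in each
  summand. It thus costs a factor equal to the l1-norm of \<open>th\<close> and raises the degree by
  at most one, so only moments of order at most \<open>m\<close> are read.\<close>

lemma hatE_sigK_power_le: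
  assumes "L \<subseteq> {..<p}" "card L + k \<le> m"
    and "\<And>K. K \<subseteq> {..<p} \<Longrightarrow> card K \<le> m \<Longrightarrow> \<bar>f K\<bar> \<le> t"
  shows "\<bar>hatE p f (\<lambda>\<sigma>. sigK \<sigma> L * (\<Sum>v<p. th v * others u \<sigma> v) ^ k)\<bar> \<le> (\<Sum>v<p. \<bar>th v\<bar>) ^ k * t"
  using assms(1,2)
proof (induction k arbitrary: L)
  case 0
  then show ?case using assms(3)[of L] by (simp add: hatE_sigK)
next
  case (Suc k)
  let ?S = "\<lambda>\<sigma>. \<Sum>v<p. th v * others u \<sigma> v"
  define L' where "L' v = (if v = u then L else toggle v L)" for v
  have fin: "finite L" using Suc.prems finite_subset by blast
  have L': "L' v \<subseteq> {..<p}" "card (L' v) + k \<le> m" if "v < p" for v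
    using Suc.prems that card_toggle_le[OF fin, of v] toggle_subset[of v "{..<p}" L]
    by (simp_all add: L'_def)
  have sig: "sigK \<sigma> (L' v) = others u \<sigma> v * sigK \<sigma> L" if "\<sigma> \<in> cube p" for \<sigma> v
    using sigK_toggle[OF that fin] by (simp add: L'_def others_def)
  have "hatE p f (\<lambda>\<sigma>. sigK \<sigma> L * ?S \<sigma> ^ Suc k) =
      hatE p f (\<lambda>\<sigma>. \<Sum>v<p. th v * (sigK \<sigma> (L' v) * ?S \<sigma> ^ k))"
    by (rule hatE_cong) (simp add: sig sum_distrib_left sum_distrib_right mult_ac)
  also have "\<dots> = (\<Sum>v<p. th v * hatE p f (\<lambda>\<sigma>. sigK \<sigma> (L' v) * ?S \<sigma> ^ k))"
    by (simp add: hatE_sum hatE_cmult)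
  also have "\<bar>\<dots>\<bar> \<le> (\<Sum>v<p. \<bar>th v\<bar> * ((\<Sum>v<p. \<bar>th v\<bar>) ^ k * t))"
    by (rule order.trans[OF sum_abs])
       (auto intro!: sum_mono mult_left_mono Suc.IH L' simp: abs_mult)
  finally show ?case by (simp add: sum_distrib_left sum_distrib_right mult_ac)
qed

text \<open>The degree \<open>k\<close> term contributes at most
  \<open>\<gamma> ^ k / fact k * t\<close>, and the exponential series sums these. The lemma is
  applied to the estimates themselves, to their deviations, and with \<open>t = 0\<close> to show
  that moments of higher order do not matter.\<close>

lemma hatE_gradient_le:
  assumes u: "u < p" and w: "w < p" and th: "(\<Sum>v<p. \<bar>th v\<bar>) \<le> \<gamma>" and t: "0 \<le> t"
    and f: "\<And>K. K \<subseteq> {..<p} \<Longrightarrow> card K \<le> d + 2 - d mod 2 \<Longrightarrow> \<bar>f K\<bar> \<le> t"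
  shows "\<bar>hatE p f (\<lambda>\<sigma>. \<sigma> u * others u \<sigma> w * Pd d (local_energy p u \<sigma> th))\<bar> \<le> exp \<gamma> * t"
proof -
  let ?S = "\<lambda>\<sigma>. \<Sum>v<p. th v * others u \<sigma> v"
  \<comment> \<open>In degree \<open>k\<close> the spin \<open>\<sigma> u\<close> occurs to the power \<open>k + 1\<close>, so it survives only for even \<open>k\<close>;
    hence the moment order \<open>d + 2 - d mod 2\<close>.\<close>
  define L0 where "L0 k = (if even k then {u} else {})" for k :: nat
  define L where "L k = (if w = u then L0 k else insert w (L0 k))" for k
  have L: "L k \<subseteq> {..<p}" for k
    using u w by (auto simp: L_def L0_def)
  have cardL: "card (L k) + k \<le> d + 2 - d mod 2" if "k \<le> d" for k
  proof -
    have "card (L k) \<le> (if even k then 2 else 1)"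
      by (auto simp: L_def L0_def card_insert_if)
    \<comment> \<open>For odd \<open>d\<close>, an even \<open>k\<close> is at most
      \<open>d - 1\<close>, which saves one order.\<close>
    moreover have "k + (if even k then 2 else 1) \<le> d + 2 - d mod 2"
      using that by (simp split: if_split) presburger
    ultimately show ?thesis by linarith
  qed
  have sig: "sigK \<sigma> (L k) = \<sigma> u ^ Suc k * others u \<sigma> w" if "\<sigma> \<in> cube p" for \<sigma> k
  proof -
    have "\<sigma> u ^ Suc k = sigK \<sigma> (L0 k)"
    proof (cases "even k")
      case True
      then obtain j where "k = 2 * j" by blast
      then show ?thesis
        using cube_square[OF that, of u] by (simp add: L0_def sigK_insert power_mult power2_eq_square)
    next
      case False
      then obtain j where "Suc k = 2 * Suc j" by (auto elim: oddE)
      then have "\<sigma> u ^ Suc k = (\<sigma> u * \<sigma> u) ^ Suc j"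
        by (metis power_mult power2_eq_square)
      with False show ?thesis
        using cube_square[OF that, of u] by (simp add: L0_def del: power_Suc)
    qed
    then show ?thesis
      by (auto simp: L_def others_def sigK_insert L0_def)
  qed
  have "hatE p f (\<lambda>\<sigma>. \<sigma> u * others u \<sigma> w * Pd d (local_energy p u \<sigma> th)) =
      hatE p f (\<lambda>\<sigma>. \<Sum>k\<le>d. (- 1) ^ k / fact k * (sigK \<sigma> (L k) * ?S \<sigma> ^ k))"
  proof (rule hatE_cong)
    fix \<sigma> assume "\<sigma> \<in> cube p"
    then show "\<sigma> u * others u \<sigma> w * Pd d (local_energy p u \<sigma> th) =
        (\<Sum>k\<le>d. (- 1) ^ k / fact k * (sigK \<sigma> (L k) * ?S \<sigma> ^ k))"
      by (simp add: sig Pd_def local_energy_others[OF u] sum_distrib_left[of _ _ "{..d}"]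
          power_minus[of "_ * _"] power_mult_distrib mult_ac)
  qed
  also have "\<dots> = (\<Sum>k\<le>d. (- 1) ^ k / fact k * hatE p f (\<lambda>\<sigma>. sigK \<sigma> (L k) * ?S \<sigma> ^ k))"
    by (simp only: hatE_sum hatE_cmult)
  also have "\<bar>\<dots>\<bar> \<le> (\<Sum>k\<le>d. \<gamma> ^ k / fact k * t)"
  proof (rule order.trans[OF sum_abs], rule sum_mono)
    fix k assume k: "k \<in> {..d}"
    have "\<bar>hatE p f (\<lambda>\<sigma>. sigK \<sigma> (L k) * ?S \<sigma> ^ k)\<bar> \<le> (\<Sum>v<p. \<bar>th v\<bar>) ^ k * t"
      by (rule hatE_sigK_power_le[OF L cardL f]) (use k in auto)
    also have "\<dots> \<le> \<gamma> ^ k * t"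
      by (intro mult_right_mono power_mono th t sum_nonneg) auto
    finally show "\<bar>(- 1) ^ k / fact k * hatE p f (\<lambda>\<sigma>. sigK \<sigma> (L k) * ?S \<sigma> ^ k)\<bar> \<le> \<gamma> ^ k / fact k * t"
      by (simp add: abs_mult divide_right_mono)
  qed
  also have "\<dots> = (\<Sum>k\<le>d. \<gamma> ^ k / fact k) * t"
    by (simp add: sum_distrib_right)
  also have "\<dots> \<le> exp \<gamma> * t"
  proof (rule mult_right_mono[OF _ t])
    have "0 \<le> \<gamma>" by (rule order.trans[OF _ th]) (simp add: sum_nonneg)
    then show "(\<Sum>k\<le>d. \<gamma> ^ k / fact k) \<le> exp \<gamma>"
      unfolding exp_def using summable_exp_generic[of \<gamma>]
      by (intro order.trans[OF _ sum_le_suminf[of _ "{..d}"]]) (auto simp: field_simps scaleR_conv_of_real)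
  qed
  finally show ?thesis .
qed

subsection \<open>Projected gradient descent on the l1-ball\<close>

text \<open>Parameter vectors are functions on all naturals, so compactness is taken in the product
  topology: the ball is a closed subset of a product of intervals. It yields the existence of the
  projection.\<close>

lemma l1ball_compact: "compactin (powertop_real UNIV) (l1ball p \<gamma>)"
proof (rule closed_compactin)
  \<comment> \<open>\<open>c\<close> is non-negative even for negative \<gamma>, so the zero
    coordinates from \<open>p\<close> on lie in the box.\<close>
  define c where "c = max 0 \<gamma>"
  have c: "0 \<le> c" "\<gamma> \<le> c" by (auto simp: c_def)
  show "compactin (powertop_real UNIV) (\<Pi>\<^sub>E i\<in>UNIV. {- c..c})"
    by (simp add: compactin_PiE)
  show "l1ball p \<gamma> \<subseteq> (\<Pi>\<^sub>E i\<in>UNIV. {- c..c})"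
  proof
    fix x assume x: "x \<in> l1ball p \<gamma>"
    have "x i \<in> {- c..c}" for i
    proof (cases "i < p")
      case True
      then have "\<bar>x i\<bar> \<le> (\<Sum>i<p. \<bar>x i\<bar>)" by (intro member_le_sum) auto
      also have "\<dots> \<le> \<gamma>" using x by (simp add: l1ball_def)
      finally show ?thesis using c by auto
    qed (use x c in \<open>auto simp: l1ball_def\<close>)
    then show "x \<in> (\<Pi>\<^sub>E i\<in>UNIV. {- c..c})" by (intro PiE_I) auto
  qed
  have "closedin (powertop_real UNIV) {x \<in> topspace (powertop_real UNIV). x i \<in> {0}}" for i
    by (rule closedin_continuous_map_preimage[of _ euclideanreal])
       (auto intro: continuous_map_product_projection)
  moreover have "closedin (powertop_real UNIV)
      {x \<in> topspace (powertop_real UNIV). (\<Sum>i<p. \<bar>x i\<bar>) \<in> {..\<gamma>}}"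
    by (rule closedin_continuous_map_preimage[of _ euclideanreal])
       (auto intro!: continuous_intros continuous_map_product_projection)
  ultimately have "closedin (powertop_real UNIV)
      ((\<Inter>i\<in>{p..}. {x \<in> topspace (powertop_real UNIV). x i \<in> {0}}) \<inter>
       {x \<in> topspace (powertop_real UNIV). (\<Sum>i<p. \<bar>x i\<bar>) \<in> {..\<gamma>}})"
    by (intro closedin_Int closedin_Inter) auto
  also have "(\<Inter>i\<in>{p..}. {x \<in> topspace (powertop_real UNIV). x i \<in> {0}}) \<inter>
       {x \<in> topspace (powertop_real UNIV). (\<Sum>i<p. \<bar>x i\<bar>) \<in> {..\<gamma>}} = l1ball p \<gamma>"
    by (auto simp: l1ball_def)
  finally show "closedin (powertop_real UNIV) (l1ball p \<gamma>)" .
qed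

lemma l1ball_convex:
  assumes "x \<in> l1ball p \<gamma>" "y \<in> l1ball p \<gamma>" "0 \<le> s" "s \<le> 1"
  shows "(\<lambda>i. (1 - s) * x i + s * y i) \<in> l1ball p \<gamma>"
proof -
  have "(\<Sum>i<p. \<bar>(1 - s) * x i + s * y i\<bar>) \<le> (\<Sum>i<p. (1 - s) * \<bar>x i\<bar> + s * \<bar>y i\<bar>)"
    using assms by (intro sum_mono order.trans[OF abs_triangle_ineq]) (simp add: abs_mult)
  also have "\<dots> = (1 - s) * (\<Sum>i<p. \<bar>x i\<bar>) + s * (\<Sum>i<p. \<bar>y i\<bar>)"
    by (simp add: sum.distrib sum_distrib_left)
  also have "\<dots> \<le> (1 - s) * \<gamma> + s * \<gamma>"
    using assms by (intro add_mono mult_left_mono) (auto simp: l1ball_def)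
  finally have "(\<Sum>i<p. \<bar>(1 - s) * x i + s * y i\<bar>) \<le> \<gamma>" by (simp add: algebra_simps)
  then show ?thesis using assms by (auto simp: l1ball_def)
qed

text \<open>First-order optimality: if the inner product were positive, a short move from
  \<open>y\<close> towards \<open>z\<close> would stay in the ball by convexity and come closer to
  \<open>x\<close>.\<close>

lemma nearest_l1ball_variational:
  assumes y: "y \<in> l1ball p \<gamma>"
    and min: "\<And>z. z \<in> l1ball p \<gamma> \<Longrightarrow> (\<Sum>i<p. (x i - y i)\<^sup>2) \<le> (\<Sum>i<p. (x i - z i)\<^sup>2)"
    and z: "z \<in> l1ball p \<gamma>"
  shows "(\<Sum>i<p. (x i - y i) * (z i - y i)) \<le> 0"
proof (rule ccontr)
  define a where "a = (\<Sum>i<p. (x i - y i) * (z i - y i))"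
  define b where "b = (\<Sum>i<p. (z i - y i)\<^sup>2)"
  assume "\<not> ?thesis"
  then have a: "a > 0" by (simp add: a_def)
  have b: "b \<ge> 0" by (simp add: b_def sum_nonneg)
  have *: "2 * s * a \<le> s\<^sup>2 * b" if "0 \<le> s" "s \<le> 1" for s
  proof -
    have "(\<Sum>i<p. (x i - ((1 - s) * y i + s * z i))\<^sup>2) =
        (\<Sum>i<p. (x i - y i)\<^sup>2 - 2 * s * ((x i - y i) * (z i - y i)) + s\<^sup>2 * (z i - y i)\<^sup>2)"
      by (intro sum.cong refl) (simp add: power2_eq_square algebra_simps)
    also have "\<dots> = (\<Sum>i<p. (x i - y i)\<^sup>2) - 2 * s * a + s\<^sup>2 * b"
      by (simp add: sum.distrib sum_subtractf sum_distrib_left a_def b_def)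
    finally show ?thesis using min[OF l1ball_convex[OF y z that]] by simp
  qed
  \<comment> \<open>Small enough that the quadratic term \<open>s\<^sup>2 * b\<close> stays below
    the linear gain \<open>2 * s * a\<close>; the \<open>+ 1\<close> keeps the denominator positive
    when \<open>b = 0\<close>.\<close>
  define s where "s = min 1 (a / (b + 1))"
  have s: "0 < s" "s \<le> 1" "s * (b + 1) \<le> a"
    using a b by (simp_all add: s_def min_def pos_le_divide_eq pos_divide_le_eq)
  have "s * (2 * a) \<le> s * (s * b)" using *[of s] s by (simp add: power2_eq_square mult_ac)
  then have "2 * a \<le> s * b" using s by simp
  with s a show False by (simp add: algebra_simps)
qed

text \<open>The projection is a definite description, so existence and uniqueness of the nearest
  point have to be settled before it can be used.\<close>

lemma proj_l1:
  assumes "0 \<le> \<gamma>"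
  shows proj_l1_in: "proj_l1 p \<gamma> x \<in> l1ball p \<gamma>"
    and proj_l1_variational:
      "z \<in> l1ball p \<gamma> \<Longrightarrow> (\<Sum>i<p. (x i - proj_l1 p \<gamma> x i) * (z i - proj_l1 p \<gamma> x i)) \<le> 0"
proof -
  define D where "D y = (\<Sum>i<p. (x i - y i)\<^sup>2)" for y
  have "continuous_map (powertop_real UNIV) euclideanreal D"
    unfolding D_def by (auto intro!: continuous_intros continuous_map_product_projection)
  then have "compactin euclideanreal (D ` l1ball p \<gamma>)"
    using image_compactin l1ball_compact by blast
  then have "compact (D ` l1ball p \<gamma>)" by simp
  moreover have "(\<lambda>_. 0) \<in> l1ball p \<gamma>" using assms by (simp add: l1ball_def)
  ultimately obtain y where y: "y \<in> l1ball p \<gamma>" "\<And>z. z \<in> l1ball p \<gamma> \<Longrightarrow> D y \<le> D z"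
    using compact_attains_inf[of "D ` l1ball p \<gamma>"] by auto
  have "y' = y" if y': "y' \<in> l1ball p \<gamma>" "\<And>z. z \<in> l1ball p \<gamma> \<Longrightarrow> D y' \<le> D z" for y'
  proof -
    \<comment> \<open>The squared distance of two nearest points is the sum of the left-hand sides
      of their variational inequalities, each tested at the other point.\<close>
    have "(\<Sum>i<p. (y i - y' i)\<^sup>2) =
        (\<Sum>i<p. (x i - y' i) * (y i - y' i)) + (\<Sum>i<p. (x i - y i) * (y' i - y i))"
      by (simp add: sum.distrib[symmetric] power2_eq_square algebra_simps)
    also have "\<dots> \<le> 0"
      using nearest_l1ball_variational[OF y' [unfolded D_def] y(1)]
        nearest_l1ball_variational[OF y [unfolded D_def] y'(1)] by simp
    finally have "(\<Sum>i<p. (y i - y' i)\<^sup>2) = 0" by (simp add: antisym sum_nonneg)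
    then have "\<forall>i<p. y i = y' i" by (simp add: sum_nonneg_eq_0_iff)
    then show "y' = y" using y(1) y'(1) by (auto simp: l1ball_def fun_eq_iff) (metis not_le)
  qed
  then have "(THE y. y \<in> l1ball p \<gamma> \<and> (\<forall>z\<in>l1ball p \<gamma>. D y \<le> D z)) = y"
    using y by (intro the_equality) blast+
  then have "proj_l1 p \<gamma> x = y"
    by (simp add: proj_l1_def D_def)
  with y show "proj_l1 p \<gamma> x \<in> l1ball p \<gamma>"
    and "z \<in> l1ball p \<gamma> \<Longrightarrow> (\<Sum>i<p. (x i - proj_l1 p \<gamma> x i) * (z i - proj_l1 p \<gamma> x i)) \<le> 0"
    using nearest_l1ball_variational[of y p \<gamma> x z] by (auto simp: D_def)
qed

text \<open>The angle at the projected point between \<open>x\<close> and any point of the ball is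
  at least a right angle, so the cross term has a favourable sign.\<close>

lemma proj_l1_nonexpansive:
  assumes "0 \<le> \<gamma>" "z \<in> l1ball p \<gamma>"
  shows "(\<Sum>i<p. (proj_l1 p \<gamma> x i - z i)\<^sup>2) \<le> (\<Sum>i<p. (x i - z i)\<^sup>2)"
proof -
  let ?y = "proj_l1 p \<gamma> x"
  have "(\<Sum>i<p. (x i - z i)\<^sup>2) =
      (\<Sum>i<p. (?y i - z i)\<^sup>2) + (\<Sum>i<p. (x i - ?y i)\<^sup>2) - 2 * (\<Sum>i<p. (x i - ?y i) * (z i - ?y i))"
    by (simp add: sum.distrib[symmetric] sum_subtractf[symmetric] sum_distrib_left power2_eq_square algebra_simps)
  moreover have "0 \<le> (\<Sum>i<p. (x i - ?y i)\<^sup>2)" by (simp add: sum_nonneg)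
  ultimately show ?thesis using proj_l1_variational[OF assms, of x] by linarith
qed

section \<open>Regret of the gradient iterates\<close>

lemma alg_iter_in_l1ball: "0 \<le> \<gamma> \<Longrightarrow> alg_iter p d \<gamma> \<eta> m u t \<in> l1ball p \<gamma>"
  by (cases t) (simp_all add: Let_def proj_l1_in, simp add: l1ball_def)

text \<open>The squared distance \<open>D\<close> to the comparison point is the potential: each
  step changes it by at most minus \<open>2 * \<eta>\<close> times the inner product plus
  \<open>\<eta>\<^sup>2 * G\<close>, and these changes telescope.\<close>

lemma alg_iter_regret:
  assumes \<gamma>: "0 \<le> \<gamma>" and \<eta>: "0 < \<eta>" and z: "z \<in> l1ball p \<gamma>"
    and G: "\<And>t. (\<Sum>i<p. (approx_grad p d m u (alg_iter p d \<gamma> \<eta> m u t) i)\<^sup>2) \<le> G"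
  shows "(\<Sum>t<T. \<Sum>i<p. approx_grad p d m u (alg_iter p d \<gamma> \<eta> m u t) i * (alg_iter p d \<gamma> \<eta> m u t i - z i))
    \<le> \<gamma>\<^sup>2 / (2 * \<eta>) + real T * (\<eta> / 2 * G)"
proof -
  define x where "x = alg_iter p d \<gamma> \<eta> m u"
  define g where "g t = approx_grad p d m u (x t)" for t
  define D where "D t = (\<Sum>i<p. (x t i - z i)\<^sup>2)" for t
  have step: "2 * \<eta> * (\<Sum>i<p. g t i * (x t i - z i)) \<le> D t - D (Suc t) + \<eta>\<^sup>2 * G" for t
  proof -
    have "D (Suc t) \<le> (\<Sum>i<p. (x t i - \<eta> * g t i - z i)\<^sup>2)"
      using proj_l1_nonexpansive[OF \<gamma> z] by (simp add: D_def x_def g_def Let_def)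
    also have "\<dots> = (\<Sum>i<p. (x t i - z i)\<^sup>2 - 2 * \<eta> * (g t i * (x t i - z i)) + \<eta>\<^sup>2 * (g t i)\<^sup>2)"
      by (intro sum.cong refl) (simp add: power2_eq_square algebra_simps)
    also have "\<dots> = D t - 2 * \<eta> * (\<Sum>i<p. g t i * (x t i - z i)) + \<eta>\<^sup>2 * (\<Sum>i<p. (g t i)\<^sup>2)"
      by (simp add: sum.distrib sum_subtractf sum_distrib_left D_def)
    also have "\<dots> \<le> D t - 2 * \<eta> * (\<Sum>i<p. g t i * (x t i - z i)) + \<eta>\<^sup>2 * G"
      using G[of t] by (intro add_left_mono mult_left_mono) (auto simp: g_def x_def)
    finally show ?thesis by simp
  qed
  \<comment> \<open>The iteration starts at the origin, so \<open>D 0\<close> is the squared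
    Euclidean norm of \<open>z\<close>, which is at most its squared l1-norm.\<close>
  have "D 0 \<le> \<gamma>\<^sup>2"
  proof -
    have "D 0 = (\<Sum>i<p. \<bar>z i\<bar> * \<bar>z i\<bar>)" by (simp add: D_def x_def power2_eq_square)
    also have "\<dots> \<le> (\<Sum>i<p. \<gamma> * \<bar>z i\<bar>)"
    proof (intro sum_mono mult_right_mono)
      fix i assume "i \<in> {..<p}"
      then have "\<bar>z i\<bar> \<le> (\<Sum>i<p. \<bar>z i\<bar>)" by (intro member_le_sum) auto
      then show "\<bar>z i\<bar> \<le> \<gamma>" using z by (simp add: l1ball_def)
    qed auto
    also have "\<dots> \<le> \<gamma> * \<gamma>"
      unfolding sum_distrib_left[symmetric] using z \<gamma> by (intro mult_left_mono) (auto simp: l1ball_def)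
    finally show ?thesis by (simp add: power2_eq_square)
  qed
  have "2 * \<eta> * (\<Sum>t<T. \<Sum>i<p. g t i * (x t i - z i)) = (\<Sum>t<T. 2 * \<eta> * (\<Sum>i<p. g t i * (x t i - z i)))"
    by (simp add: sum_distrib_left)
  also have "\<dots> \<le> (\<Sum>t<T. (D t - D (Suc t)) + \<eta>\<^sup>2 * G)"
    by (rule sum_mono) (rule step)
  also have "\<dots> = D 0 - D T + real T * (\<eta>\<^sup>2 * G)"
    by (simp only: sum.distrib sum_lessThan_telescope') simp
  also have "\<dots> \<le> \<gamma>\<^sup>2 + real T * (\<eta>\<^sup>2 * G)"
  proof -
    have "0 \<le> D T" by (simp add: D_def sum_nonneg)
    with \<open>D 0 \<le> \<gamma>\<^sup>2\<close> show ?thesis by simp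
  qed
  finally have "(\<Sum>t<T. \<Sum>i<p. g t i * (x t i - z i)) \<le> (\<gamma>\<^sup>2 + real T * (\<eta>\<^sup>2 * G)) / (2 * \<eta>)"
    using \<eta> by (simp add: field_simps)
  also have "\<dots> = \<gamma>\<^sup>2 / (2 * \<eta>) + real T * (\<eta> / 2 * G)"
    using \<eta> by (simp add: field_simps power2_eq_square)
  finally show ?thesis by (simp add: g_def x_def)
qed

subsection \<open>The interaction screening objective\<close>

text \<open>The true local parameters in the layout of \<open>local_energy\<close>, extended by zero
  so that they belong to \<open>l1ball\<close>.\<close>

definition local_par :: "nat \<Rightarrow> (nat \<Rightarrow> nat \<Rightarrow> real) \<Rightarrow> (nat \<Rightarrow> real) \<Rightarrow> nat \<Rightarrow> nat \<Rightarrow> real" where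
  "local_par p th h u = (\<lambda>i. if i = u then h u else if i < p then th u i else 0)"

lemma local_par_in_l1ball:
  assumes "l1_width_le p th h \<gamma>" "u < p"
  shows "local_par p th h u \<in> l1ball p \<gamma>"
proof -
  have "(\<Sum>i<p. \<bar>local_par p th h u i\<bar>) = \<bar>h u\<bar> + (\<Sum>v\<in>{..<p} - {u}. \<bar>th u v\<bar>)"
    using assms(2) by (simp add: sum.remove[of _ u] local_par_def)
  with assms show ?thesis by (auto simp: l1ball_def local_par_def l1_width_le_def)
qed

text \<open>Isolates the dependence on one spin: the remainder \<open>R\<close> collects the terms
  without \<open>\<sigma> w\<close>, so it cancels when a configuration is compared with its
  flip.\<close>

lemma ising_energy_local:
  assumes sym: "\<forall>v<p. \<forall>w<p. th v w = th w v" and w: "w < p"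
  obtains R where
    "\<And>\<sigma>. ising_energy p th h \<sigma> = local_energy p w \<sigma> (local_par p th h w) + R \<sigma>"
    "\<And>\<sigma>. R (flip w \<sigma>) = R \<sigma>"
proof
  define Q where "Q = Sigma {..<p} (\<lambda>a. {a<..<p})"
  define R where "R \<sigma> = (\<Sum>(a, b)\<in>{e\<in>Q. fst e \<noteq> w \<and> snd e \<noteq> w}. th a b * \<sigma> a * \<sigma> b)
    + (\<Sum>a\<in>{..<p} - {w}. h a * \<sigma> a)" for \<sigma>
  have fin: "finite Q" by (simp add: Q_def)
  show "R (flip w \<sigma>) = R \<sigma>" for \<sigma>
    unfolding R_def by (intro arg_cong2[of _ _ _ _ "(+)"] sum.cong) auto
  fix \<sigma>
  let ?f = "\<lambda>(a, b). th a b * \<sigma> a * \<sigma> b"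
  \<comment> \<open>Pairs are stored in increasing order, so \<open>w\<close> is either the first or
    the second entry. In the second case the symmetry of the couplings turns \<open>th a w\<close>
    into \<open>th w a\<close>.\<close>
  have Qw: "{e\<in>Q. \<not> (fst e \<noteq> w \<and> snd e \<noteq> w)} = Pair w ` {w<..<p} \<union> (\<lambda>a. (a, w)) ` {..<w}"
    using w by (auto simp: Q_def)
  have "(\<Sum>u<p. \<Sum>v\<in>{u<..<p}. th u v * \<sigma> u * \<sigma> v) = sum ?f Q"
    by (simp add: Q_def sum.Sigma)
  also have "\<dots> = sum ?f {e\<in>Q. fst e \<noteq> w \<and> snd e \<noteq> w} + sum ?f {e\<in>Q. \<not> (fst e \<noteq> w \<and> snd e \<noteq> w)}"
    by (subst sum.union_disjoint[symmetric]) (auto simp: fin intro!: sum.cong)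
  also have "sum ?f {e\<in>Q. \<not> (fst e \<noteq> w \<and> snd e \<noteq> w)} =
      sum ?f (Pair w ` {w<..<p}) + sum ?f ((\<lambda>a. (a, w)) ` {..<w})"
    unfolding Qw by (subst sum.union_disjoint) auto
  also have "sum ?f (Pair w ` {w<..<p}) = (\<Sum>v\<in>{w<..<p}. \<sigma> w * (th w v * \<sigma> v))"
    by (subst sum.reindex) (auto simp: inj_on_def mult_ac)
  also have "sum ?f ((\<lambda>a. (a, w)) ` {..<w}) = (\<Sum>v<w. \<sigma> w * (th w v * \<sigma> v))"
    by (subst sum.reindex) (use w sym in \<open>auto simp: inj_on_def mult_ac intro!: sum.cong\<close>)
  also have "(\<Sum>v\<in>{w<..<p}. \<sigma> w * (th w v * \<sigma> v)) + (\<Sum>v<w. \<sigma> w * (th w v * \<sigma> v)) =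
      (\<Sum>v\<in>{..<p} - {w}. \<sigma> w * (th w v * \<sigma> v))"
    by (subst sum.union_disjoint[symmetric]) (use w in \<open>auto intro!: sum.cong\<close>)
  finally have *: "(\<Sum>u<p. \<Sum>v\<in>{u<..<p}. th u v * \<sigma> u * \<sigma> v) =
      sum ?f {e\<in>Q. fst e \<noteq> w \<and> snd e \<noteq> w} + (\<Sum>v\<in>{..<p} - {w}. \<sigma> w * (th w v * \<sigma> v))" .
  have "local_energy p w \<sigma> (local_par p th h w) =
      \<sigma> w * h w + (\<Sum>v\<in>{..<p} - {w}. \<sigma> w * (th w v * \<sigma> v))"
    by (simp add: local_energy_def local_par_def distrib_left sum_distrib_left)
  moreover have "(\<Sum>a<p. h a * \<sigma> a) = h w * \<sigma> w + (\<Sum>a\<in>{..<p} - {w}. h a * \<sigma> a)"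
    using w by (simp add: sum.remove)
  ultimately show "ising_energy p th h \<sigma> = local_energy p w \<sigma> (local_par p th h w) + R \<sigma>"
    unfolding ising_energy_def * R_def by simp
qed

lemma local_energy_flip: "local_energy p w (flip w \<sigma>) x = - local_energy p w \<sigma> x"
proof -
  have "(\<Sum>v\<in>{..<p} - {w}. x v * flip w \<sigma> v) = (\<Sum>v\<in>{..<p} - {w}. x v * \<sigma> v)"
    by (intro sum.cong) auto
  then show ?thesis by (simp add: local_energy_def)
qed

lemma partition_function_pos: "0 < (\<Sum>\<tau>\<in>cube p. exp (ising_energy p th h \<tau>))"
  using cube_ne by (intro sum_pos) auto

lemma ising_prob_nonneg: "0 \<le> ising_prob p th h \<sigma>"
  using partition_function_pos[of p th h] by (simp add: ising_prob_def)

lemma sum_ising_prob: "(\<Sum>\<sigma>\<in>cube p. ising_prob p th h \<sigma>) = 1"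
  using partition_function_pos[of p th h] by (simp add: ising_prob_def sum_divide_distrib[symmetric])

lemma abs_others: "\<sigma> \<in> cube p \<Longrightarrow> \<bar>others u \<sigma> v\<bar> = 1"
  by (simp add: others_def cube_abs)

lemma abs_local_energy_le:
  assumes "\<sigma> \<in> cube p" "u < p"
  shows "\<bar>local_energy p u \<sigma> x\<bar> \<le> (\<Sum>v<p. \<bar>x v\<bar>)"
proof -
  have "\<bar>local_energy p u \<sigma> x\<bar> = \<bar>\<Sum>v<p. x v * others u \<sigma> v\<bar>"
    by (simp add: local_energy_others[OF assms(2)] abs_mult cube_abs[OF assms(1)])
  also have "\<dots> \<le> (\<Sum>v<p. \<bar>x v * others u \<sigma> v\<bar>)" by (rule sum_abs)
  finally show ?thesis by (simp add: abs_mult abs_others[OF assms(1)])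
qed

text \<open>For non-negative \<open>x\<close>, clearing denominators leaves
  \<open>2 + x - exp x * (2 - x) \<ge> 0\<close>, which holds at 0 and has derivative
  \<open>1 - exp x * (1 - x) \<ge> 0\<close>. For negative \<open>x\<close> the quadratic Taylor
  bound is already stronger.\<close>

lemma exp_remainder_lower:
  fixes x :: real
  shows "x\<^sup>2 / (2 + \<bar>x\<bar>) \<le> exp (- x) - 1 + x"
proof (cases "0 \<le> x")
  case True
  have "(\<lambda>x. 2 + x - exp x * (2 - x)) 0 \<le> (\<lambda>x. 2 + x - exp x * (2 - x :: real)) x"
  proof (rule DERIV_nonneg_imp_nondecreasing[OF True])
    fix t :: real
    have "exp t * (1 - t) \<le> exp t * exp (- t)"
      using exp_ge_add_one_self[of "- t"] by (intro mult_left_mono) auto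
    then have "0 \<le> 1 - exp t * (1 - t)" by (simp add: exp_minus)
    then show "\<exists>y. ((\<lambda>x. 2 + x - exp x * (2 - x)) has_real_derivative y) (at t) \<and> 0 \<le> y"
      by (intro exI[of _ "1 - exp t * (1 - t)"] conjI)
         (auto intro!: derivative_eq_intros simp: algebra_simps)
  qed
  then have "2 - x \<le> exp (- x) * (2 + x)" by (simp add: exp_minus field_simps)
  then have "x\<^sup>2 \<le> (exp (- x) - 1 + x) * (2 + x)" by (simp add: power2_eq_square algebra_simps)
  with True show ?thesis by (simp add: field_simps)
next
  case False
  have "1 + (- x) + (- x)\<^sup>2 / 2 \<le> exp (- x)"
    using False by (intro exp_lower_Taylor_quadratic) auto
  then have "x\<^sup>2 / 2 * (2 - x) \<le> (exp (- x) - 1 + x) * (2 - x)"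
    using False by (intro mult_right_mono) auto
  moreover have "x\<^sup>2 \<le> x\<^sup>2 / 2 * (2 - x)"
    using mult_nonneg_nonneg[of "x\<^sup>2" "- x"] False by (simp add: algebra_simps)
  ultimately show ?thesis using False by (simp add: field_simps)
qed

definition screening :: "nat \<Rightarrow> ((nat \<Rightarrow> real) \<Rightarrow> real) \<Rightarrow> nat \<Rightarrow> (nat \<Rightarrow> real) \<Rightarrow> real" where
  "screening p \<mu> u x = (\<Sum>\<sigma>\<in>cube p. \<mu> \<sigma> * exp (- local_energy p u \<sigma> x))"

text \<open>The gradient of \<open>screening\<close> in closed form. Instead of differentiation, the
  proof uses its inner products as expanded in \<open>screening_grad_inner\<close>.\<close>

definition screening_grad :: "nat \<Rightarrow> ((nat \<Rightarrow> real) \<Rightarrow> real) \<Rightarrow> nat \<Rightarrow> (nat \<Rightarrow> real) \<Rightarrow> nat \<Rightarrow> real" where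
  "screening_grad p \<mu> u x w =
     - (\<Sum>\<sigma>\<in>cube p. \<mu> \<sigma> * (\<sigma> u * others u \<sigma> w * exp (- local_energy p u \<sigma> x)))"

section \<open>Convexity of the screening objective\<close>

lemma local_energy_diff:
  assumes "u < p"
  shows "local_energy p u \<sigma> x - local_energy p u \<sigma> y = (\<Sum>w<p. \<sigma> u * others u \<sigma> w * (x w - y w))"
  by (simp add: local_energy_others[OF assms] sum_distrib_left sum_subtractf[symmetric] algebra_simps)

text \<open>Exchanging the sums turns an inner product with the gradient into an expectation of
  energy differences, so that convexity can be checked configuration by configuration.\<close>

lemma screening_grad_inner:
  assumes "u < p"
  shows "(\<Sum>w<p. screening_grad p \<mu> u x w * (z w - y w)) =
    (\<Sum>\<sigma>\<in>cube p. \<mu> \<sigma> * (exp (- local_energy p u \<sigma> x) * (local_energy p u \<sigma> y - local_energy p u \<sigma> z)))"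
  unfolding screening_grad_def local_energy_diff[OF assms]
  by (simp add: sum_negf[symmetric] sum_distrib_left sum_distrib_right sum.swap[of _ "cube p"]
      algebra_simps)

text \<open>Pointwise this is \<open>1 + s \<le> exp s\<close>, with \<open>s\<close> the difference
  of the two energies.\<close>

lemma screening_subgradient:
  assumes "u < p" "\<And>\<sigma>. 0 \<le> \<mu> \<sigma>"
  shows "screening p \<mu> u x + (\<Sum>w<p. screening_grad p \<mu> u x w * (y w - x w)) \<le> screening p \<mu> u y"
  unfolding screening_grad_inner[OF assms(1)] screening_def sum.distrib[symmetric] distrib_left[symmetric]
proof (intro sum_mono mult_left_mono assms)
  fix \<sigma>
  let ?a = "local_energy p u \<sigma> x" and ?b = "local_energy p u \<sigma> y"
  have "exp (- ?a) * (1 + (?a - ?b)) \<le> exp (- ?a) * exp (?a - ?b)"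
    by (intro mult_left_mono exp_ge_add_one_self) simp
  then show "exp (- ?a) + exp (- ?a) * (?a - ?b) \<le> exp (- ?b)"
    by (simp add: exp_add[symmetric] algebra_simps)
qed

text \<open>Jensen's inequality, by summing the subgradient inequalities at the average: the linear
  terms cancel.\<close>

lemma screening_average_le:
  fixes x :: "nat \<Rightarrow> nat \<Rightarrow> real"
  assumes "u < p" "\<And>\<sigma>. 0 \<le> \<mu> \<sigma>" "0 < T"
  defines "a \<equiv> \<lambda>i. (\<Sum>t<T. x t i) / real T"
  shows "real T * screening p \<mu> u a \<le> (\<Sum>t<T. screening p \<mu> u (x t))"
proof -
  have "(\<Sum>t<T. \<Sum>w<p. screening_grad p \<mu> u a w * (x t w - a w)) =
      (\<Sum>w<p. screening_grad p \<mu> u a w * (\<Sum>t<T. x t w - a w))"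
    by (subst sum.swap) (simp add: sum_distrib_left)
  also have "\<dots> = 0"
    using assms(3) by (simp add: sum_subtractf a_def)
  finally have "real T * screening p \<mu> u a =
      (\<Sum>t<T. screening p \<mu> u a + (\<Sum>w<p. screening_grad p \<mu> u a w * (x t w - a w)))"
    by (simp add: sum.distrib)
  also have "\<dots> \<le> (\<Sum>t<T. screening p \<mu> u (x t))"
    by (intro sum_mono screening_subgradient assms)
  finally show ?thesis .
qed

text \<open>The normalising constant and the remainder \<open>R\<close> cancel in the ratio, while
  the local energy changes sign.\<close>

lemma ising_prob_flip:
  assumes "\<forall>v<p. \<forall>w<p. th v w = th w v" "w < p" "\<sigma> \<in> cube p"
  shows "ising_prob p th h (flip w \<sigma>) =
    exp (- 2 * local_energy p w \<sigma> (local_par p th h w)) * ising_prob p th h \<sigma>"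
proof -
  obtain R where R: "\<And>\<sigma>. ising_energy p th h \<sigma> = local_energy p w \<sigma> (local_par p th h w) + R \<sigma>"
    "\<And>\<sigma>. R (flip w \<sigma>) = R \<sigma>"
    using ising_energy_local[OF assms(1,2)] by blast
  have "flip w \<sigma> \<in> cube p" using assms by blast
  with assms(3) show ?thesis
    by (simp add: ising_prob_def R local_energy_flip exp_add[symmetric])
qed

text \<open>Under the flip at \<open>u\<close> the factor \<open>exp (- 2 * E)\<close> of the
  probability turns \<open>exp E\<close> back into \<open>exp (- E)\<close>. Only the sign of
  \<open>\<sigma> u\<close> changes, so the summand is odd.\<close>

lemma screening_grad_true_par:
  assumes "\<forall>v<p. \<forall>w<p. th v w = th w v" "u < p" "w < p"
  shows "screening_grad p (ising_prob p th h) u (local_par p th h u) w = 0"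
proof -
  have "(\<Sum>\<sigma>\<in>cube p. ising_prob p th h \<sigma> *
      (\<sigma> u * others u \<sigma> w * exp (- local_energy p u \<sigma> (local_par p th h u)))) = 0"
    by (rule sum_cube_odd[OF assms(2)])
       (simp add: ising_prob_flip[OF assms(1,2)] local_energy_flip others_def mult_ac flip: exp_add)
  then show ?thesis by (simp add: screening_grad_def)
qed

text \<open>Pairing each configuration with its flip at \<open>w\<close> leaves the part of the linear form that
  depends on \<open>\<sigma> w\<close>; flipping changes the probability by a factor of at most \<open>exp (2 * \<gamma>)\<close>.\<close>
lemma ising_second_moment_lower:
  assumes sym: "\<forall>v<p. \<forall>w<p. th v w = th w v"
    and width: "l1_width_le p th h \<gamma>" and w: "w < p" "w \<noteq> u"
  shows "exp (- 2 * \<gamma>) * (b w)\<^sup>2 \<le> (\<Sum>\<sigma>\<in>cube p. ising_prob p th h \<sigma> * (\<Sum>v<p. b v * others u \<sigma> v)\<^sup>2)"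
proof -
  let ?\<mu> = "ising_prob p th h" and ?x = "\<lambda>\<sigma>. \<Sum>v<p. b v * others u \<sigma> v"
  define a where "a \<sigma> = (\<Sum>v\<in>{..<p} - {w}. b v * others u \<sigma> v)" for \<sigma>
  have x: "?x \<sigma> = b w * \<sigma> w + a \<sigma>" for \<sigma>
    using w by (simp add: sum.remove[of _ w] a_def others_def)
  have a_flip: "a (flip w \<sigma>) = a \<sigma>" for \<sigma>
    unfolding a_def by (intro sum.cong) (auto simp: others_def)
  have pt: "2 * (exp (- 2 * \<gamma>) * ((b w)\<^sup>2 * ?\<mu> \<sigma>)) \<le> ?\<mu> \<sigma> * (?x \<sigma>)\<^sup>2 + ?\<mu> (flip w \<sigma>) * (?x (flip w \<sigma>))\<^sup>2"
    if \<sigma>: "\<sigma> \<in> cube p" for \<sigma>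
  proof -
    have "(\<Sum>v<p. \<bar>local_par p th h w v\<bar>) \<le> \<gamma>"
      using local_par_in_l1ball[OF width w(1)] by (simp add: l1ball_def)
    then have E: "\<bar>local_energy p w \<sigma> (local_par p th h w)\<bar> \<le> \<gamma>"
      using abs_local_energy_le[OF \<sigma> w(1)] order.trans by blast
    have 1: "exp (- 2 * \<gamma>) * ?\<mu> \<sigma> \<le> ?\<mu> (flip w \<sigma>)"
      unfolding ising_prob_flip[OF sym w(1) \<sigma>] using E
      by (intro mult_right_mono ising_prob_nonneg) auto
    \<comment> \<open>\<open>E\<close> enters through its consequence
      \<open>0 \<le> \<gamma>\<close>, which makes the exponential factor at most 1.\<close>
    have 2: "exp (- 2 * \<gamma>) * ?\<mu> \<sigma> \<le> ?\<mu> \<sigma>"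
      using E mult_right_mono[of "exp (- 2 * \<gamma>)" 1 "?\<mu> \<sigma>"] ising_prob_nonneg[of p th h \<sigma>] by simp
    have sq: "(\<sigma> w)\<^sup>2 = 1" using cube_square[OF \<sigma>] by (simp add: power2_eq_square)
    \<comment> \<open>The cross terms \<open>2 * b w * \<sigma> w * a \<sigma>\<close> have opposite
      signs in the two squares and cancel.\<close>
    have "(?x \<sigma>)\<^sup>2 + (?x (flip w \<sigma>))\<^sup>2 = 2 * ((b w)\<^sup>2 * (\<sigma> w)\<^sup>2) + 2 * (a \<sigma>)\<^sup>2"
      by (simp add: x a_flip power2_eq_square algebra_simps)
    then have 3: "2 * (b w)\<^sup>2 \<le> (?x \<sigma>)\<^sup>2 + (?x (flip w \<sigma>))\<^sup>2" by (simp add: sq)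
    have "exp (- 2 * \<gamma>) * ?\<mu> \<sigma> * (2 * (b w)\<^sup>2) \<le> exp (- 2 * \<gamma>) * ?\<mu> \<sigma> * ((?x \<sigma>)\<^sup>2 + (?x (flip w \<sigma>))\<^sup>2)"
      using 3 by (intro mult_left_mono) (simp_all add: ising_prob_nonneg)
    also have "\<dots> \<le> ?\<mu> \<sigma> * (?x \<sigma>)\<^sup>2 + ?\<mu> (flip w \<sigma>) * (?x (flip w \<sigma>))\<^sup>2"
      unfolding distrib_left using 1 2 by (intro add_mono mult_right_mono) auto
    finally show ?thesis by (simp add: mult_ac)
  qed
  have "2 * (exp (- 2 * \<gamma>) * (b w)\<^sup>2) = (\<Sum>\<sigma>\<in>cube p. 2 * (exp (- 2 * \<gamma>) * ((b w)\<^sup>2 * ?\<mu> \<sigma>)))"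
    by (simp add: sum_distrib_left[symmetric] sum_ising_prob)
  also have "\<dots> \<le> (\<Sum>\<sigma>\<in>cube p. ?\<mu> \<sigma> * (?x \<sigma>)\<^sup>2 + ?\<mu> (flip w \<sigma>) * (?x (flip w \<sigma>))\<^sup>2)"
    by (intro sum_mono pt)
  also have "\<dots> = 2 * (\<Sum>\<sigma>\<in>cube p. ?\<mu> \<sigma> * (?x \<sigma>)\<^sup>2)"
    using sum_cube_flip[OF w(1), of "\<lambda>\<sigma>. ?\<mu> \<sigma> * (?x \<sigma>)\<^sup>2"] by (simp add: sum.distrib)
  finally show ?thesis by simp
qed

lemma screening_growth:
  assumes sym: "\<forall>v<p. \<forall>w<p. th v w = th w v"
    and width: "l1_width_le p th h \<gamma>" and \<gamma>: "0 \<le> \<gamma>"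
    and u: "u < p" and w: "w < p" "w \<noteq> u" and x: "x \<in> l1ball p \<gamma>"
  defines "\<mu> \<equiv> ising_prob p th h"
  shows "exp (- 3 * \<gamma>) * (x w - th u w)\<^sup>2 / (2 * (1 + \<gamma>)) \<le>
    screening p \<mu> u x - screening p \<mu> u (local_par p th h u)"
proof -
  let ?y = "local_par p th h u"
  define b where "b v = x v - ?y v" for v
  define D where "D \<sigma> = local_energy p u \<sigma> x - local_energy p u \<sigma> ?y" for \<sigma>
  have l1: "(\<Sum>v<p. \<bar>x v\<bar>) \<le> \<gamma>" "(\<Sum>v<p. \<bar>?y v\<bar>) \<le> \<gamma>"
    using x local_par_in_l1ball[OF width u] by (auto simp: l1ball_def)
  \<comment> \<open>By stationarity the linear term in \<open>D\<close> has mean zero, so it can be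
    added to the difference of the objectives for free.\<close>
  have "(\<Sum>w<p. screening_grad p \<mu> u ?y w * (x w - ?y w)) = 0"
    unfolding \<mu>_def by (intro sum.neutral) (simp add: screening_grad_true_par[OF sym u])
  then have lin: "(\<Sum>\<sigma>\<in>cube p. \<mu> \<sigma> * (exp (- local_energy p u \<sigma> ?y) * D \<sigma>)) = 0"
    unfolding screening_grad_inner[OF u] D_def
    by (simp add: sum_negf[symmetric] right_diff_distrib sum_subtractf)
  have pt: "exp (- \<gamma>) * (\<Sum>v<p. b v * others u \<sigma> v)\<^sup>2 / (2 * (1 + \<gamma>)) \<le>
      exp (- local_energy p u \<sigma> ?y) * (exp (- D \<sigma>) - 1 + D \<sigma>)" if \<sigma>: "\<sigma> \<in> cube p" for \<sigma>
  proof -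
    have E: "\<bar>local_energy p u \<sigma> x\<bar> \<le> \<gamma>" "\<bar>local_energy p u \<sigma> ?y\<bar> \<le> \<gamma>"
      using abs_local_energy_le[OF \<sigma> u] l1 order.trans by blast+
    then have D: "\<bar>D \<sigma>\<bar> \<le> 2 * \<gamma>" by (simp add: D_def)
    have "D \<sigma> = \<sigma> u * (\<Sum>v<p. b v * others u \<sigma> v)"
      unfolding D_def local_energy_diff[OF u] b_def by (simp add: sum_distrib_left mult_ac)
    then have "(D \<sigma>)\<^sup>2 = (\<Sum>v<p. b v * others u \<sigma> v)\<^sup>2"
      using cube_square[OF \<sigma>, of u] by (simp add: power_mult_distrib power2_eq_square[of "\<sigma> u"])
    \<comment> \<open>Both vectors lie in the ball, so
      \<open>\<bar>D \<sigma>\<bar> \<le> 2 * \<gamma>\<close>; this gives the denominator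
      \<open>2 * (1 + \<gamma>)\<close>.\<close>
    moreover have "(D \<sigma>)\<^sup>2 / (2 * (1 + \<gamma>)) \<le> (D \<sigma>)\<^sup>2 / (2 + \<bar>D \<sigma>\<bar>)"
      using D by (intro divide_left_mono) (auto intro!: mult_pos_pos)
    ultimately have "(\<Sum>v<p. b v * others u \<sigma> v)\<^sup>2 / (2 * (1 + \<gamma>)) \<le> exp (- D \<sigma>) - 1 + D \<sigma>"
      using exp_remainder_lower[of "D \<sigma>"] by simp
    then have "exp (- \<gamma>) * ((\<Sum>v<p. b v * others u \<sigma> v)\<^sup>2 / (2 * (1 + \<gamma>))) \<le>
      exp (- local_energy p u \<sigma> ?y) * (exp (- D \<sigma>) - 1 + D \<sigma>)"
      using E \<gamma> by (intro mult_mono) auto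
    then show ?thesis by simp
  qed
  \<comment> \<open>One factor \<open>exp (- \<gamma>)\<close> comes from the weight at the true
    parameters, the other \<open>exp (- 2 * \<gamma>)\<close> from the second moment bound.\<close>
  have "exp (- 3 * \<gamma>) * (x w - th u w)\<^sup>2 / (2 * (1 + \<gamma>)) =
      exp (- \<gamma>) / (2 * (1 + \<gamma>)) * (exp (- 2 * \<gamma>) * (b w)\<^sup>2)"
    using w by (simp add: b_def local_par_def flip: mult.assoc exp_add)
  also have "\<dots> \<le> exp (- \<gamma>) / (2 * (1 + \<gamma>)) * (\<Sum>\<sigma>\<in>cube p. \<mu> \<sigma> * (\<Sum>v<p. b v * others u \<sigma> v)\<^sup>2)"
    using \<gamma> unfolding \<mu>_def
    by (intro mult_left_mono ising_second_moment_lower[OF sym width w]) auto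
  also have "\<dots> = (\<Sum>\<sigma>\<in>cube p. \<mu> \<sigma> * (exp (- \<gamma>) * (\<Sum>v<p. b v * others u \<sigma> v)\<^sup>2 / (2 * (1 + \<gamma>))))"
    by (simp add: sum_distrib_left mult_ac)
  also have "\<dots> \<le> (\<Sum>\<sigma>\<in>cube p. \<mu> \<sigma> * (exp (- local_energy p u \<sigma> ?y) * (exp (- D \<sigma>) - 1 + D \<sigma>)))"
    unfolding \<mu>_def by (intro sum_mono mult_left_mono pt ising_prob_nonneg)
  also have "\<dots> = (\<Sum>\<sigma>\<in>cube p. \<mu> \<sigma> * exp (- local_energy p u \<sigma> x) - \<mu> \<sigma> * exp (- local_energy p u \<sigma> ?y)
      + \<mu> \<sigma> * (exp (- local_energy p u \<sigma> ?y) * D \<sigma>))"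
    by (intro sum.cong refl) (simp add: D_def algebra_simps flip: exp_add)
  also have "\<dots> = screening p \<mu> u x - screening p \<mu> u ?y"
    by (simp add: sum.distrib sum_subtractf lin screening_def)
  finally show ?thesis .
qed

subsection \<open>Truncation error and accuracy of the algorithm\<close>

text \<open>Existence is the intermediate value theorem on \<open>{0..x}\<close>. Any solution for
  positive \<open>x\<close> is positive, and \<open>y * exp y\<close> is strictly increasing there,
  so the definite description is determined.\<close>

lemma lambertW_pos:
  assumes "0 < x"
  shows "0 < lambertW x" "lambertW x * exp (lambertW x) = x"
proof -
  have "\<exists>y\<ge>0. y \<le> x \<and> y * exp y = x"
    by (rule IVT') (use assms in \<open>auto intro!: continuous_intros\<close>)
  then obtain y where y: "0 \<le> y" "y * exp y = x" by blast
  have pos: "0 < z" if "z * exp z = x" for z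
    using assms that by (metis exp_gt_zero zero_less_mult_pos2)
  have less: "y * exp y < z * exp z" if "0 < y" "y < z" for y z :: real
    using that by (intro mult_strict_mono) auto
  have uniq: "z = y" if z: "z * exp z = x" for z
  proof (cases z y rule: linorder_cases)
    case lt: less
    from less[OF pos[OF z] lt] y(2) z show ?thesis by simp
  next
    case greater
    from less[OF pos[OF y(2)] greater] y(2) z show ?thesis by simp
  qed simp
  have "lambertW x = y"
    unfolding lambertW_def
  proof (rule the_equality)
    show "- 1 \<le> y \<and> y * exp y = x" using y by simp
    show "z = y" if "- 1 \<le> z \<and> z * exp z = x" for z
      using that by (intro uniq) (rule conjunct2)
  qed
  with y(2) pos[OF y(2)] show "0 < lambertW x" "lambertW x * exp (lambertW x) = x"
    by simp_all
qed

text \<open>A Stirling-type bound with exponent \<open>n\<close> instead of \<open>n + 1\<close>.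
  The factor \<open>exp 1\<close> gained this way later absorbs the constant 2 of the series tail.
  The induction step is \<open>(1 + 1 / N) ^ N \<le> exp 1\<close>.\<close>

lemma Suc_power_le_fact_exp: "real (Suc n) ^ Suc n \<le> fact (Suc n) * exp (real n)"
proof (induction n)
  case (Suc n)
  have "(1 + 1 / real (Suc n)) ^ Suc n \<le> exp (1 / real (Suc n)) ^ Suc n"
    by (intro power_mono) auto
  also have "\<dots> = exp 1" by (simp only: exp_of_nat_mult[symmetric]) simp
  finally have e: "(1 + 1 / real (Suc n)) ^ Suc n \<le> exp 1" .
  have "real (Suc (Suc n)) = real (Suc n) * (1 + 1 / real (Suc n))" by (simp add: field_simps)
  then have "real (Suc (Suc n)) ^ Suc n = real (Suc n) ^ Suc n * (1 + 1 / real (Suc n)) ^ Suc n"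
    by (metis power_mult_distrib)
  also have "\<dots> \<le> (fact (Suc n) * exp (real n)) * exp 1"
    using Suc.IH e by (intro mult_mono) auto
  also have "\<dots> = fact (Suc n) * exp (real (Suc n))" by (simp add: exp_add)
  finally have "real (Suc (Suc n)) * real (Suc (Suc n)) ^ Suc n \<le>
      real (Suc (Suc n)) * (fact (Suc n) * exp (real (Suc n)))"
    by (intro mult_left_mono) auto
  then show ?case by (simp add: mult_ac)
qed simp

text \<open>Beyond degree \<open>d\<close> consecutive terms shrink at least by half, so the tail is
  at most twice the bound on the first omitted term.\<close>

lemma Pd_approx:
  assumes x: "\<bar>x\<bar> \<le> \<gamma>" and N: "2 * \<gamma> \<le> real (Suc d)"
  shows "\<bar>Pd d x - exp (- x)\<bar> \<le> 2 * (\<gamma> ^ Suc d / fact (Suc d))"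
proof -
  define c where "c = \<gamma> ^ Suc d / fact (Suc d)"
  define a where "a k = (- x) ^ k / fact k" for k
  have \<gamma>: "0 \<le> \<gamma>" using x by simp
  have sums: "a sums exp (- x)"
    using exp_converges[of "- x"] by (simp add: a_def[abs_def] field_simps)
  have tail: "(\<lambda>k. a (k + Suc d)) sums (exp (- x) - Pd d x)"
    using sums_split_initial_segment[OF sums, of "Suc d"] by (simp add: Pd_def a_def lessThan_Suc_atMost)
  have maj: "\<bar>a (k + Suc d)\<bar> \<le> c * (1 / 2) ^ k" for k
  proof -
    have "\<gamma> ^ (k + Suc d) / fact (k + Suc d) \<le> c * (1 / 2) ^ k"
    proof (induction k)
      case (Suc k)
      have "\<gamma> / real (Suc (k + Suc d)) \<le> 1 / 2"
        using N by (simp add: field_simps)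
      then have "\<gamma> ^ (k + Suc d) / fact (k + Suc d) * (\<gamma> / real (Suc (k + Suc d))) \<le>
          c * (1 / 2) ^ k * (1 / 2)"
        using Suc.IH \<gamma> by (intro mult_mono) (auto simp: c_def)
      then show ?case by (simp add: mult_ac)
    qed (simp add: c_def)
    moreover have "\<bar>a (k + Suc d)\<bar> \<le> \<gamma> ^ (k + Suc d) / fact (k + Suc d)"
      unfolding a_def using power_mono[OF x, of "k + Suc d"]
      by (simp add: power_abs divide_right_mono del: fact_Suc power_Suc)
    ultimately show ?thesis by linarith
  qed
  have geo: "(\<lambda>k. c * (1 / 2) ^ k) sums (c * 2)"
    using sums_mult[OF geometric_sums[of "1 / 2 :: real"], of c] by simp
  have "\<bar>exp (- x) - Pd d x\<bar> \<le> c * 2"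
    using norm_suminf_le[of "\<lambda>k. a (k + Suc d)" "\<lambda>k. c * (1 / 2) ^ k"] maj
      sums_summable[OF geo] sums_unique[OF geo] sums_unique[OF tail] by simp
  then show ?thesis unfolding c_def by (subst abs_minus_commute) (simp only: mult.commute)
qed

text \<open>With \<open>N = Suc d\<close>, the defining equation of the Lambert function turns the
  hypothesis into \<open>N \<ge> \<gamma> * exp 1 * exp w\<close>. Hence
  \<open>(\<gamma> * exp 1 / N) ^ N \<le> exp (- w * N)\<close>, and \<open>w * N \<ge> L\<close>
  holds by the same hypothesis.\<close>

lemma truncation_error:
  assumes \<gamma>: "0 < \<gamma>" and A: "1 \<le> A"
    and N: "(3 * \<gamma> + ln A) / lambertW (3 / exp 1 + ln A / (\<gamma> * exp 1)) \<le> real (Suc d)"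
    and x: "\<bar>x\<bar> \<le> \<gamma>"
  shows "\<bar>Pd d x - exp (- x)\<bar> \<le> exp (- 3 * \<gamma>) / A"
proof -
  define L where "L = 3 * \<gamma> + ln A"
  define w where "w = lambertW (L / (\<gamma> * exp 1))"
  have L: "0 < L" using \<gamma> A by (simp add: L_def add_pos_nonneg)
  have w: "0 < w" "w * exp w = L / (\<gamma> * exp 1)"
    unfolding w_def using lambertW_pos[of "L / (\<gamma> * exp 1)"] \<gamma> L by simp_all
  have "3 / exp 1 + ln A / (\<gamma> * exp 1) = L / (\<gamma> * exp 1)"
    using \<gamma> by (simp add: L_def field_simps)
  with N have N': "L / w \<le> real (Suc d)" by (simp add: w_def L_def)
  have Lw: "L / w = \<gamma> * exp 1 * exp w"
    using w \<gamma> by (simp add: field_simps)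
  have "exp 1 \<ge> (2 :: real)" using exp_ge_add_one_self[of 1] by simp
  moreover have "exp w \<ge> 1" using w by simp
  ultimately have "2 * 1 \<le> exp 1 * exp w" by (intro mult_mono) auto
  then have "\<gamma> * 2 \<le> \<gamma> * (exp 1 * exp w)" using \<gamma> by (intro mult_left_mono) auto
  with N' Lw have N2: "2 * \<gamma> \<le> real (Suc d)" by (simp add: mult_ac)
  have wN: "L \<le> w * real (Suc d)" using N' w by (simp add: pos_divide_le_eq mult_ac)
  have "\<gamma> * exp 1 \<le> exp (- w) * real (Suc d)"
    using N' unfolding Lw by (simp add: exp_minus field_simps)
  then have "(\<gamma> * exp 1) ^ Suc d \<le> (exp (- w) * real (Suc d)) ^ Suc d"
    using \<gamma> by (intro power_mono) auto
  also have "\<dots> = exp (- w) ^ Suc d * real (Suc d) ^ Suc d" by (rule power_mult_distrib)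
  also have "exp (- w) ^ Suc d = exp (- (w * real (Suc d)))"
    by (simp only: exp_of_nat_mult[symmetric]) (simp add: algebra_simps)
  also have "exp (- (w * real (Suc d))) * real (Suc d) ^ Suc d \<le> exp (- L) * (fact (Suc d) * exp (real d))"
    using wN by (intro mult_mono Suc_power_le_fact_exp) auto
  finally have "\<gamma> ^ Suc d * exp 1 * exp (real d) \<le> exp (- L) * fact (Suc d) * exp (real d)"
    by (simp add: power_mult_distrib exp_of_nat_mult[symmetric] exp_add mult_ac)
  \<comment> \<open>The factor \<open>exp 1\<close> that remains is at least 2 and pays for the
    factor 2 of \<open>Pd_approx\<close>.\<close>
  then have "\<gamma> ^ Suc d * exp 1 \<le> exp (- L) * fact (Suc d)" by simp
  moreover have "2 * \<gamma> ^ Suc d \<le> \<gamma> ^ Suc d * exp 1"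
    using \<open>exp 1 \<ge> 2\<close> \<gamma> by (subst mult.commute, intro mult_left_mono) auto
  ultimately have "2 * \<gamma> ^ Suc d \<le> exp (- L) * fact (Suc d)" by linarith
  then have "2 * (\<gamma> ^ Suc d / fact (Suc d)) \<le> exp (- L)"
    by (simp add: pos_divide_le_eq del: fact_Suc power_Suc)
  with Pd_approx[OF x N2] have "\<bar>Pd d x - exp (- x)\<bar> \<le> exp (- L)" by linarith
  also have "exp (- L) = exp (- 3 * \<gamma>) / A"
    using A by (simp add: L_def exp_diff)
  finally show ?thesis .
qed

section \<open>From accurate moments to accurate parameters\<close>

lemma approx_grad_others:
  "w < p \<Longrightarrow> approx_grad p d m u x w =
     - hatE p m (\<lambda>\<sigma>. \<sigma> u * others u \<sigma> w * Pd d (local_energy p u \<sigma> x))"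
  by (simp add: approx_grad_def others_def)

lemma approx_grad_le:
  assumes "u < p" "w < p" "x \<in> l1ball p \<gamma>"
    and "\<And>K. K \<subseteq> {..<p} \<Longrightarrow> card K \<le> d + 2 - d mod 2 \<Longrightarrow> \<bar>m K\<bar> \<le> 1"
  shows "\<bar>approx_grad p d m u x w\<bar> \<le> exp \<gamma>"
  using hatE_gradient_le[of u p w x \<gamma> 1 d m] assms
  by (simp add: approx_grad_others l1ball_def)

lemma approx_grad_error:
  assumes u: "u < p" and w: "w < p" and x: "x \<in> l1ball p \<gamma>" and t: "0 \<le> t"
    and \<mu>: "\<And>\<sigma>. 0 \<le> \<mu> \<sigma>" "(\<Sum>\<sigma>\<in>cube p. \<mu> \<sigma>) = 1"
    and m: "\<And>K. K \<subseteq> {..<p} \<Longrightarrow> card K \<le> d + 2 - d mod 2 \<Longrightarrow>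
       \<bar>m K - (\<Sum>\<sigma>\<in>cube p. \<mu> \<sigma> * sigK \<sigma> K)\<bar> \<le> t"
    and e: "\<And>y. \<bar>y\<bar> \<le> \<gamma> \<Longrightarrow> \<bar>Pd d y - exp (- y)\<bar> \<le> e"
  shows "\<bar>approx_grad p d m u x w - screening_grad p \<mu> u x w\<bar> \<le> exp \<gamma> * t + e"
proof -
  define q where "q \<sigma> = \<sigma> u * others u \<sigma> w * Pd d (local_energy p u \<sigma> x)" for \<sigma>
  define r where "r \<sigma> = \<sigma> u * others u \<sigma> w * exp (- local_energy p u \<sigma> x)" for \<sigma>
  have l1: "(\<Sum>v<p. \<bar>x v\<bar>) \<le> \<gamma>" using x by (simp add: l1ball_def)
  have "hatE p m q - (\<Sum>\<sigma>\<in>cube p. \<mu> \<sigma> * q \<sigma>) =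
      hatE p (\<lambda>K. m K - (\<Sum>\<sigma>\<in>cube p. \<mu> \<sigma> * sigK \<sigma> K)) q"
    by (simp add: hatE_diff hatE_expectation)
  also have "\<bar>\<dots>\<bar> \<le> exp \<gamma> * t"
    unfolding q_def by (rule hatE_gradient_le[OF u w l1 t]) (rule m)
  finally have 1: "\<bar>hatE p m q - (\<Sum>\<sigma>\<in>cube p. \<mu> \<sigma> * q \<sigma>)\<bar> \<le> exp \<gamma> * t" .
  have "\<bar>(\<Sum>\<sigma>\<in>cube p. \<mu> \<sigma> * q \<sigma>) - (\<Sum>\<sigma>\<in>cube p. \<mu> \<sigma> * r \<sigma>)\<bar> = \<bar>\<Sum>\<sigma>\<in>cube p. \<mu> \<sigma> * (q \<sigma> - r \<sigma>)\<bar>"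
    by (simp add: sum_subtractf right_diff_distrib)
  also have "\<dots> \<le> (\<Sum>\<sigma>\<in>cube p. \<mu> \<sigma> * e)"
  proof (rule order.trans[OF sum_abs], rule sum_mono)
    fix \<sigma> assume \<sigma>: "\<sigma> \<in> cube p"
    have "\<bar>q \<sigma> - r \<sigma>\<bar> = \<bar>Pd d (local_energy p u \<sigma> x) - exp (- local_energy p u \<sigma> x)\<bar>"
      unfolding q_def r_def right_diff_distrib[symmetric]
      by (simp add: abs_mult cube_abs[OF \<sigma>] abs_others[OF \<sigma>])
    also have "\<dots> \<le> e"
      using abs_local_energy_le[OF \<sigma> u, of x] l1 by (intro e) linarith
    finally show "\<bar>\<mu> \<sigma> * (q \<sigma> - r \<sigma>)\<bar> \<le> \<mu> \<sigma> * e"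
      using \<mu>(1)[of \<sigma>] by (simp add: abs_mult mult_left_mono)
  qed
  also have "\<dots> = e" using \<mu>(2) by (simp add: sum_distrib_right[symmetric])
  finally have 2: "\<bar>(\<Sum>\<sigma>\<in>cube p. \<mu> \<sigma> * q \<sigma>) - (\<Sum>\<sigma>\<in>cube p. \<mu> \<sigma> * r \<sigma>)\<bar> \<le> e" .
  have "approx_grad p d m u x w = - hatE p m q"
    using w by (simp add: approx_grad_others q_def[abs_def])
  moreover have "screening_grad p \<mu> u x w = - (\<Sum>\<sigma>\<in>cube p. \<mu> \<sigma> * r \<sigma>)"
    by (simp add: screening_grad_def r_def)
  ultimately show ?thesis using 1 2 by linarith
qed

text \<open>The excess at each iterate is at most the inner product with the exact gradient.
  Replacing that by the approximate gradient leaves a regret term and an error term; averaging the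
  iterates then uses convexity.\<close>

lemma screening_excess:
  assumes u: "u < p" and \<gamma>: "0 \<le> \<gamma>" and \<eta>: "0 < \<eta>" and T: "0 < T" and y: "y \<in> l1ball p \<gamma>"
    and \<mu>: "\<And>\<sigma>. 0 \<le> \<mu> \<sigma>"
    and G: "\<And>x w. x \<in> l1ball p \<gamma> \<Longrightarrow> w < p \<Longrightarrow> \<bar>approx_grad p d m u x w\<bar> \<le> exp \<gamma>"
    and err: "\<And>x w. x \<in> l1ball p \<gamma> \<Longrightarrow> w < p \<Longrightarrow>
       \<bar>approx_grad p d m u x w - screening_grad p \<mu> u x w\<bar> \<le> e"
  shows "screening p \<mu> u (algorithm1 p d \<gamma> \<eta> T m u) - screening p \<mu> u y \<le>
    \<gamma>\<^sup>2 / (2 * \<eta> * real T) + \<eta> / 2 * (real p * exp (2 * \<gamma>)) + 2 * \<gamma> * e"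
proof -
  define x where "x = alg_iter p d \<gamma> \<eta> m u"
  define g where "g t = approx_grad p d m u (x t)" for t
  define s where "s t = screening_grad p \<mu> u (x t)" for t
  have x: "x t \<in> l1ball p \<gamma>" for t
    using alg_iter_in_l1ball[OF \<gamma>] by (simp add: x_def)
  have "0 \<le> e" using err[OF y u] by linarith
  have sq: "(\<Sum>i<p. (approx_grad p d m u (alg_iter p d \<gamma> \<eta> m u t) i)\<^sup>2) \<le> real p * exp (2 * \<gamma>)" for t
  proof -
    have "(approx_grad p d m u (x t) i)\<^sup>2 \<le> exp (2 * \<gamma>)" if "i < p" for i
      using power_mono[OF G[OF x that], of t 2] by (simp add: exp_double)
    then show ?thesis
      using sum_bounded_above[of "{..<p}" "\<lambda>i. (approx_grad p d m u (x t) i)\<^sup>2" "exp (2 * \<gamma>)"]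
      by (simp add: x_def)
  qed
  have pt: "screening p \<mu> u (x t) - screening p \<mu> u y \<le> (\<Sum>i<p. g t i * (x t i - y i)) + 2 * \<gamma> * e" for t
  proof -
    have "screening p \<mu> u (x t) - screening p \<mu> u y \<le> (\<Sum>i<p. s t i * (x t i - y i))"
      using screening_subgradient[where \<mu> = \<mu> and x = "x t" and y = y, OF u \<mu>]
      by (simp add: s_def right_diff_distrib sum_subtractf)
    also have "\<dots> = (\<Sum>i<p. g t i * (x t i - y i)) + (\<Sum>i<p. (s t i - g t i) * (x t i - y i))"
      by (simp add: sum.distrib[symmetric] algebra_simps)
    \<comment> \<open>Hoelder's inequality: supremum norm of the gradient error against the
      l1-distance, which is at most \<open>2 * \<gamma>\<close>.\<close>
    also have "(\<Sum>i<p. (s t i - g t i) * (x t i - y i)) \<le> (\<Sum>i<p. e * (\<bar>x t i\<bar> + \<bar>y i\<bar>))"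
    proof (rule sum_mono)
      fix i assume "i \<in> {..<p}"
      then have "\<bar>s t i - g t i\<bar> \<le> e"
        using err[OF x, of i t] by (simp add: s_def g_def abs_minus_commute)
      then have "\<bar>(s t i - g t i) * (x t i - y i)\<bar> \<le> e * (\<bar>x t i\<bar> + \<bar>y i\<bar>)"
        unfolding abs_mult using \<open>0 \<le> e\<close> by (intro mult_mono) auto
      then show "(s t i - g t i) * (x t i - y i) \<le> e * (\<bar>x t i\<bar> + \<bar>y i\<bar>)" by linarith
    qed
    also have "\<dots> = e * ((\<Sum>i<p. \<bar>x t i\<bar>) + (\<Sum>i<p. \<bar>y i\<bar>))"
      by (simp add: sum_distrib_left[symmetric] sum.distrib)
    also have "\<dots> \<le> e * (\<gamma> + \<gamma>)"
      using x[of t] y \<open>0 \<le> e\<close> by (intro mult_left_mono add_mono) (auto simp: l1ball_def)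
    finally show ?thesis by (simp add: mult_ac)
  qed
  have "real T * (screening p \<mu> u (algorithm1 p d \<gamma> \<eta> T m u) - screening p \<mu> u y) \<le>
      (\<Sum>t<T. screening p \<mu> u (x t) - screening p \<mu> u y)"
    using screening_average_le[where \<mu> = \<mu> and x = x, OF u \<mu> T]
    by (simp add: algorithm1_def x_def right_diff_distrib sum_subtractf)
  also have "\<dots> \<le> (\<Sum>t<T. (\<Sum>i<p. g t i * (x t i - y i)) + 2 * \<gamma> * e)"
    by (rule sum_mono) (rule pt)
  also have "\<dots> \<le> \<gamma>\<^sup>2 / (2 * \<eta>) + real T * (\<eta> / 2 * (real p * exp (2 * \<gamma>))) + real T * (2 * \<gamma> * e)"
    using alg_iter_regret[OF \<gamma> \<eta> y sq] by (simp add: sum.distrib g_def x_def)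
  also have "\<dots> = real T * (\<gamma>\<^sup>2 / (2 * \<eta> * real T) + \<eta> / 2 * (real p * exp (2 * \<gamma>)) + 2 * \<gamma> * e)"
    using T \<eta> by (simp add: field_simps)
  finally show ?thesis using T by simp
qed

lemma step_size_bound:
  fixes \<gamma> \<epsilon> P T :: real
  assumes \<gamma>: "0 < \<gamma>" and \<epsilon>: "0 < \<epsilon>" and P: "0 < P"
    and T: "576 * P * \<gamma>\<^sup>2 * exp (8 * \<gamma>) * (1 + \<gamma>)\<^sup>2 / \<epsilon> ^ 4 \<le> T"
  defines "\<eta> \<equiv> 2 * \<gamma> * exp (- \<gamma>) / (3 * sqrt (P * T))"
  shows "\<gamma>\<^sup>2 / (2 * \<eta> * T) + \<eta> / 2 * (P * exp (2 * \<gamma>)) \<le> exp (- 3 * \<gamma>) * \<epsilon>\<^sup>2 / (16 * (1 + \<gamma>))"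
proof -
  define s where "s = sqrt (P * T)"
  \<comment> \<open>The square root of \<open>P\<close> times the lower bound on \<open>T\<close>,
    with 24 the root of 576; it bounds \<open>s\<close> from below.\<close>
  define b where "b = 24 * P * \<gamma> * exp (4 * \<gamma>) * (1 + \<gamma>) / \<epsilon>\<^sup>2"
  have b: "0 < b" using assms by (simp add: b_def)
  have "0 < 576 * P * \<gamma>\<^sup>2 * exp (8 * \<gamma>) * (1 + \<gamma>)\<^sup>2 / \<epsilon> ^ 4" using \<gamma> \<epsilon> P by simp
  then have T0: "0 < T" using T by linarith
  have "exp (4 * \<gamma>) ^ 2 = exp (8 * \<gamma>)" by (simp add: exp_double[symmetric])
  moreover have "(\<epsilon>\<^sup>2)\<^sup>2 = \<epsilon> ^ 4" by (simp flip: power_mult)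
  ultimately have "b\<^sup>2 = P * (576 * P * \<gamma>\<^sup>2 * exp (8 * \<gamma>) * (1 + \<gamma>)\<^sup>2 / \<epsilon> ^ 4)"
    unfolding b_def power_mult_distrib power_divide by (simp add: power2_eq_square[of P])
  also have "\<dots> \<le> P * T" using T P by (intro mult_left_mono) auto
  finally have bs: "b \<le> s" unfolding s_def by (rule real_le_rsqrt)
  have s: "0 < s" "s * s = P * T" using P T0 by (auto simp: s_def)
  have ee: "exp (2 * \<gamma>) * exp (- \<gamma>) = exp \<gamma>" by (simp add: exp_add[symmetric])
  have "\<gamma>\<^sup>2 / (2 * \<eta> * T) = 3 / 4 * \<gamma> * exp \<gamma> * s / T"
    using \<gamma> T0 s by (simp add: \<eta>_def s_def[symmetric] exp_minus power2_eq_square field_simps)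
  also have "\<dots> = 3 / 4 * \<gamma> * exp \<gamma> * P / s"
    using s T0 by (simp add: field_simps)
  finally have 1: "\<gamma>\<^sup>2 / (2 * \<eta> * T) = 3 / 4 * \<gamma> * exp \<gamma> * P / s" .
  have "\<eta> / 2 * (P * exp (2 * \<gamma>)) = 1 / 3 * \<gamma> * (exp (2 * \<gamma>) * exp (- \<gamma>)) * P / s"
    by (simp add: \<eta>_def s_def[symmetric])
  \<comment> \<open>The two terms contribute 3/4 and 1/3 of the same quantity; dividing their sum
    13/12 by 24 gives 13/288, which is below 1/16.\<close>
  with 1 have "\<gamma>\<^sup>2 / (2 * \<eta> * T) + \<eta> / 2 * (P * exp (2 * \<gamma>)) = 13 / 12 * (\<gamma> * exp \<gamma> * P) / s"
    unfolding ee by (simp add: field_simps)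
  also have "\<dots> \<le> 13 / 12 * (\<gamma> * exp \<gamma> * P) / b"
    using bs b s \<gamma> P by (intro divide_left_mono) auto
  also have "\<dots> = 13 / 288 * (exp \<gamma> / exp (4 * \<gamma>)) * \<epsilon>\<^sup>2 / (1 + \<gamma>)"
  proof -
    define D where "D = 1 + \<gamma>"
    have "0 < D" using \<gamma> by (simp add: D_def)
    then show ?thesis
      using \<gamma> P \<epsilon> unfolding b_def D_def[symmetric] by (simp add: field_simps)
  qed
  also have "exp \<gamma> / exp (4 * \<gamma>) = exp (- 3 * \<gamma>)" by (simp add: exp_diff[symmetric])
  also have "13 / 288 * exp (- 3 * \<gamma>) * \<epsilon>\<^sup>2 / (1 + \<gamma>) \<le> 1 / 16 * exp (- 3 * \<gamma>) * \<epsilon>\<^sup>2 / (1 + \<gamma>)"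
    using \<gamma> by (intro divide_right_mono mult_right_mono) auto
  finally show ?thesis by (simp add: field_simps)
qed

text \<open>Error budget in units of
  \<open>exp (- 3 * \<gamma>) * \<epsilon>\<^sup>2 / (1 + \<gamma>)\<close>: optimisation 1/16,
  sampling 1/4, truncation 1/8. The total 7/16 is below the 1/2 at which
  \<open>screening_growth\<close> would only just give \<epsilon>.\<close>

lemma algorithm1_accurate:
  fixes p d T :: nat and \<gamma> \<epsilon> :: real
  assumes p: "0 < p" and \<gamma>: "0 < \<gamma>" and \<epsilon>: "0 < \<epsilon>" "\<epsilon> \<le> 4 * \<gamma>"
    and sym: "\<forall>v<p. \<forall>w<p. th v w = th w v" and width: "l1_width_le p th h \<gamma>"
    and u: "u < p" and v: "v < p" "v \<noteq> u"
    and d: "(3 * \<gamma> + ln (16 * \<gamma> * (1 + \<gamma>) / \<epsilon>\<^sup>2)) /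
       lambertW (3 / exp 1 + ln (16 * \<gamma> * (1 + \<gamma>) / \<epsilon>\<^sup>2) / (\<gamma> * exp 1)) \<le> real (Suc d)"
    and T: "576 * real p * \<gamma>\<^sup>2 * exp (8 * \<gamma>) * (1 + \<gamma>)\<^sup>2 / \<epsilon> ^ 4 \<le> real T"
    and m1: "\<And>K. K \<subseteq> {..<p} \<Longrightarrow> card K \<le> d + 2 - d mod 2 \<Longrightarrow> \<bar>m K\<bar> \<le> 1"
    and m: "\<And>K. K \<subseteq> {..<p} \<Longrightarrow> card K \<le> d + 2 - d mod 2 \<Longrightarrow>
       \<bar>m K - (\<Sum>\<sigma>\<in>cube p. ising_prob p th h \<sigma> * sigK \<sigma> K)\<bar> \<le> \<epsilon>\<^sup>2 * exp (- 4 * \<gamma>) / (8 * \<gamma> * (1 + \<gamma>))"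
  shows "\<bar>algorithm1 p d \<gamma> (2 * \<gamma> * exp (- \<gamma>) / (3 * sqrt (real p * real T))) T m u v - th u v\<bar> \<le> \<epsilon>"
proof -
  define \<eta> where "\<eta> = 2 * \<gamma> * exp (- \<gamma>) / (3 * sqrt (real p * real T))"
  define x where "x = algorithm1 p d \<gamma> \<eta> T m u"
  define y where "y = local_par p th h u"
  define \<mu> where "\<mu> = ising_prob p th h"
  define A where "A = 16 * \<gamma> * (1 + \<gamma>) / \<epsilon>\<^sup>2"
  define t where "t = \<epsilon>\<^sup>2 * exp (- 4 * \<gamma>) / (8 * \<gamma> * (1 + \<gamma>))"
  have "0 < 576 * real p * \<gamma>\<^sup>2 * exp (8 * \<gamma>) * (1 + \<gamma>)\<^sup>2 / \<epsilon> ^ 4" using \<gamma> \<epsilon> p by simp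
  then have T0: "0 < T" using T by (metis of_nat_0_less_iff order.strict_trans2)
  have \<eta>: "0 < \<eta>" using \<gamma> p T0 by (simp add: \<eta>_def)
  \<comment> \<open>Here \<open>\<epsilon> \<le> 4 * \<gamma>\<close> enters: it makes
    \<open>ln A\<close> non-negative, as the truncation bound requires.\<close>
  have "\<epsilon>\<^sup>2 \<le> (4 * \<gamma>)\<^sup>2" using \<epsilon> by (intro power_mono) auto
  then have A: "1 \<le> A" using \<epsilon> \<gamma> by (simp add: A_def pos_le_divide_eq power2_eq_square algebra_simps)
  have t: "0 \<le> t" using \<gamma> by (simp add: t_def)
  have y: "y \<in> l1ball p \<gamma>" unfolding y_def by (rule local_par_in_l1ball[OF width u])
  have err: "\<bar>approx_grad p d m u x w - screening_grad p \<mu> u x w\<bar> \<le> exp \<gamma> * t + exp (- 3 * \<gamma>) / A"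
    if "x \<in> l1ball p \<gamma>" "w < p" for x w
  proof (rule approx_grad_error[OF u that(2,1) t])
    show "\<bar>Pd d y - exp (- y)\<bar> \<le> exp (- 3 * \<gamma>) / A" if "\<bar>y\<bar> \<le> \<gamma>" for y
      by (rule truncation_error[OF \<gamma> A _ that]) (use d in \<open>simp add: A_def\<close>)
  qed (use m in \<open>simp_all add: \<mu>_def ising_prob_nonneg sum_ising_prob t_def\<close>)
  \<comment> \<open>The growth bound holds on the ball, so the average of the iterates has to be
    placed there.\<close>
  have xin: "x \<in> l1ball p \<gamma>"
  proof -
    have "(\<Sum>i<p. \<bar>x i\<bar>) \<le> (\<Sum>i<p. (\<Sum>t<T. \<bar>alg_iter p d \<gamma> \<eta> m u t i\<bar>) / real T)"
      unfolding x_def algorithm1_def by (intro sum_mono) (auto intro!: divide_right_mono)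
    also have "\<dots> = (\<Sum>t<T. \<Sum>i<p. \<bar>alg_iter p d \<gamma> \<eta> m u t i\<bar>) / real T"
      by (simp add: sum_divide_distrib[symmetric] sum.swap[of _ "{..<T}"])
    also have "\<dots> \<le> (\<Sum>t<T. \<gamma>) / real T"
      using alg_iter_in_l1ball[of \<gamma> p d \<eta> m u] \<gamma>
      by (intro divide_right_mono sum_mono) (auto simp: l1ball_def)
    also have "\<dots> = \<gamma>" using T0 by simp
    finally show ?thesis
      using alg_iter_in_l1ball[of \<gamma> p d \<eta> m u] \<gamma>
      by (auto simp: l1ball_def x_def algorithm1_def)
  qed
  have "exp (- 3 * \<gamma>) * (x v - th u v)\<^sup>2 / (2 * (1 + \<gamma>)) \<le> screening p \<mu> u x - screening p \<mu> u y"
    unfolding \<mu>_def y_def using \<gamma> by (intro screening_growth[OF sym width _ u v xin]) auto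
  also have "\<dots> \<le> \<gamma>\<^sup>2 / (2 * \<eta> * real T) + \<eta> / 2 * (real p * exp (2 * \<gamma>))
      + 2 * \<gamma> * (exp \<gamma> * t + exp (- 3 * \<gamma>) / A)"
    unfolding x_def
    by (rule screening_excess[OF u _ \<eta> T0 y])
       (use \<gamma> err approx_grad_le[OF u _ _ m1] in \<open>auto simp: \<mu>_def ising_prob_nonneg\<close>)
  also have "\<dots> \<le> exp (- 3 * \<gamma>) * \<epsilon>\<^sup>2 / (16 * (1 + \<gamma>)) + 2 * \<gamma> * (exp \<gamma> * t + exp (- 3 * \<gamma>) / A)"
    using step_size_bound[OF \<gamma> \<epsilon>(1) _ T] p by (simp add: \<eta>_def)
  also have "exp \<gamma> * t = exp (- 3 * \<gamma>) * \<epsilon>\<^sup>2 / (8 * \<gamma> * (1 + \<gamma>))"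
  proof -
    have "exp \<gamma> * exp (- 4 * \<gamma>) = exp (- 3 * \<gamma>)" by (simp add: exp_add[symmetric])
    then show ?thesis by (simp add: t_def mult_ac)
  qed
  also have "exp (- 3 * \<gamma>) * \<epsilon>\<^sup>2 / (16 * (1 + \<gamma>)) +
      2 * \<gamma> * (exp (- 3 * \<gamma>) * \<epsilon>\<^sup>2 / (8 * \<gamma> * (1 + \<gamma>)) + exp (- 3 * \<gamma>) / A) =
      exp (- 3 * \<gamma>) * (7 / 8 * \<epsilon>\<^sup>2) / (2 * (1 + \<gamma>))"
  proof -
    have "2 * \<gamma> * (exp (- 3 * \<gamma>) * \<epsilon>\<^sup>2 / (8 * \<gamma> * (1 + \<gamma>))) = exp (- 3 * \<gamma>) * \<epsilon>\<^sup>2 / (4 * (1 + \<gamma>))"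
      "2 * \<gamma> * (exp (- 3 * \<gamma>) / A) = exp (- 3 * \<gamma>) * \<epsilon>\<^sup>2 / (8 * (1 + \<gamma>))"
      using \<gamma> by (simp_all add: A_def divide_simps)
    moreover have "e / (16 * D) + (e / (4 * D) + e / (8 * D)) = e * (7 / 8) / (2 * D)" for e D :: real
      by (cases "D = 0") (simp_all add: field_simps)
    from this[of "exp (- 3 * \<gamma>) * \<epsilon>\<^sup>2" "1 + \<gamma>"]
    have "exp (- 3 * \<gamma>) * \<epsilon>\<^sup>2 / (16 * (1 + \<gamma>)) + (exp (- 3 * \<gamma>) * \<epsilon>\<^sup>2 / (4 * (1 + \<gamma>)) +
        exp (- 3 * \<gamma>) * \<epsilon>\<^sup>2 / (8 * (1 + \<gamma>))) = exp (- 3 * \<gamma>) * (7 / 8 * \<epsilon>\<^sup>2) / (2 * (1 + \<gamma>))"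
      by (simp only: mult_ac)
    ultimately show ?thesis by (simp only: distrib_left[of "2 * \<gamma>"])
  qed
  finally have "exp (- 3 * \<gamma>) * (x v - th u v)\<^sup>2 \<le> exp (- 3 * \<gamma>) * (7 / 8 * \<epsilon>\<^sup>2)"
    using \<gamma> by (subst (asm) divide_le_cancel) auto
  then have "(x v - th u v)\<^sup>2 \<le> 7 / 8 * \<epsilon>\<^sup>2"
    by (subst (asm) mult_le_cancel_left_pos) auto
  moreover have "7 / 8 * \<epsilon>\<^sup>2 \<le> \<epsilon>\<^sup>2" by simp
  ultimately have "\<bar>x v - th u v\<bar>\<^sup>2 \<le> \<epsilon>\<^sup>2" unfolding power2_abs by linarith
  then have "\<bar>x v - th u v\<bar> \<le> \<epsilon>" using \<epsilon>(1) by (rule power2_le_imp_le[OF _ less_imp_le])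
  then show ?thesis by (simp add: x_def \<eta>_def)
qed

subsection \<open>Sampling error\<close>

text \<open>\<open>hatE\<close> formally sums over all subsets; the gradient bound with
  \<open>t = 0\<close>, applied to the difference of the moments, shows that those of higher order
  have no influence.\<close>

lemma approx_grad_cong:
  assumes u: "u < p"
    and m: "\<And>K. K \<subseteq> {..<p} \<Longrightarrow> card K \<le> d + 2 - d mod 2 \<Longrightarrow> m K = m' K"
  shows "approx_grad p d m u x = approx_grad p d m' u x"
proof
  fix w
  show "approx_grad p d m u x w = approx_grad p d m' u x w"
  proof (cases "w < p")
    case True
    have "\<bar>hatE p (\<lambda>K. m K - m' K) (\<lambda>\<sigma>. \<sigma> u * others u \<sigma> w * Pd d (local_energy p u \<sigma> x))\<bar>
        \<le> exp (\<Sum>v<p. \<bar>x v\<bar>) * 0"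
      by (rule hatE_gradient_le[OF u True]) (simp_all add: m)
    with True show ?thesis by (simp add: approx_grad_others hatE_diff)
  qed (simp add: approx_grad_def)
qed

lemma algorithm1_cong:
  assumes "u < p"
    and "\<And>K. K \<subseteq> {..<p} \<Longrightarrow> card K \<le> d + 2 - d mod 2 \<Longrightarrow> m K = m' K"
  shows "algorithm1 p d \<gamma> \<eta> T m u = algorithm1 p d \<gamma> \<eta> T m' u"
proof -
  have "alg_iter p d \<gamma> \<eta> m u t = alg_iter p d \<gamma> \<eta> m' u t" for t
    by (induction t) (simp_all add: Let_def approx_grad_cong[of u p d m m', OF assms])
  then show ?thesis by (simp add: algorithm1_def)
qed

text \<open>Such an event is a finite union of cylinder events. This gives measurability of the
  success event without any regularity of the projection or the iteration.\<close>

lemma sets_determined_by_finitely_many: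
  assumes I: "finite I" and C: "finite C"
    and X: "\<And>i. i \<in> I \<Longrightarrow> X i \<in> measurable M (count_space UNIV)"
    and range: "\<And>i \<omega>. i \<in> I \<Longrightarrow> \<omega> \<in> space M \<Longrightarrow> X i \<omega> \<in> C"
    and Q: "\<And>\<omega> \<omega>'. \<omega> \<in> space M \<Longrightarrow> \<omega>' \<in> space M \<Longrightarrow> (\<And>i. i \<in> I \<Longrightarrow> X i \<omega> = X i \<omega>') \<Longrightarrow> Q \<omega> \<Longrightarrow> Q \<omega>'"
  shows "{\<omega> \<in> space M. Q \<omega>} \<in> sets M"
proof -
  define F where "F = (\<lambda>\<omega>. restrict (\<lambda>i. X i \<omega>) I) ` {\<omega> \<in> space M. Q \<omega>}"
  have "F \<subseteq> (\<Pi>\<^sub>E i\<in>I. C)" using range by (auto simp: F_def)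
  then have "finite F" using I C finite_PiE finite_subset by metis
  moreover have "{\<omega> \<in> space M. \<forall>i\<in>I. X i \<omega> = f i} \<in> sets M" for f
  proof (rule sets.sets_Collect_finite_All[OF _ I])
    fix i assume "i \<in> I"
    have "X i -` {f i} \<inter> space M \<in> sets M"
      using measurable_sets[OF X[OF \<open>i \<in> I\<close>], of "{f i}"] by simp
    also have "X i -` {f i} \<inter> space M = {\<omega> \<in> space M. X i \<omega> = f i}" by auto
    finally show "{\<omega> \<in> space M. X i \<omega> = f i} \<in> sets M" .
  qed
  ultimately have "(\<Union>f\<in>F. {\<omega> \<in> space M. \<forall>i\<in>I. X i \<omega> = f i}) \<in> sets M"
    by (intro sets.finite_UN) auto
  also have "(\<Union>f\<in>F. {\<omega> \<in> space M. \<forall>i\<in>I. X i \<omega> = f i}) = {\<omega> \<in> space M. Q \<omega>}"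
  proof (intro equalityI subsetI)
    fix \<omega> assume "\<omega> \<in> (\<Union>f\<in>F. {\<omega> \<in> space M. \<forall>i\<in>I. X i \<omega> = f i})"
    then obtain \<omega>' where "\<omega>' \<in> space M" "Q \<omega>'" "\<omega> \<in> space M" "\<forall>i\<in>I. X i \<omega> = X i \<omega>'"
      by (auto simp: F_def)
    then show "\<omega> \<in> {\<omega> \<in> space M. Q \<omega>}" using Q[of \<omega>' \<omega>] by auto
  qed (auto simp: F_def)
  finally show ?thesis .
qed

lemma (in prob_space) expectation_finite_valued:
  fixes f :: "'b \<Rightarrow> real"
  assumes C: "finite C" and X: "X \<in> measurable M (count_space UNIV)"
    and range: "\<And>\<omega>. \<omega> \<in> space M \<Longrightarrow> X \<omega> \<in> C"
  shows "expectation (\<lambda>\<omega>. f (X \<omega>)) = (\<Sum>c\<in>C. prob {\<omega> \<in> space M. X \<omega> = c} * f c)"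
proof -
  have ev: "{\<omega> \<in> space M. X \<omega> = c} \<in> events" for c
    using measurable_sets[OF X, of "{c}"] by (simp add: vimage_def Int_def conj_commute)
  have "expectation (\<lambda>\<omega>. f (X \<omega>)) =
      expectation (\<lambda>\<omega>. \<Sum>c\<in>C. f c * indicator {\<omega> \<in> space M. X \<omega> = c} \<omega>)"
  proof (rule Bochner_Integration.integral_cong[OF refl])
    fix \<omega> assume \<omega>: "\<omega> \<in> space M"
    have "(\<Sum>c\<in>C. f c * indicator {\<omega> \<in> space M. X \<omega> = c} \<omega>) = (\<Sum>c\<in>C. if c = X \<omega> then f c else 0)"
      by (intro sum.cong) (use \<omega> in \<open>auto simp: indicator_def\<close>)
    then show "f (X \<omega>) = (\<Sum>c\<in>C. f c * indicator {\<omega> \<in> space M. X \<omega> = c} \<omega>)"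
      using range[OF \<omega>] C by simp
  qed
  also have "\<dots> = (\<Sum>c\<in>C. expectation (\<lambda>\<omega>. f c * indicator {\<omega> \<in> space M. X \<omega> = c} \<omega>))"
    by (rule Bochner_Integration.integral_sum) (use ev in \<open>auto simp: emeasure_eq_measure\<close>)
  also have "\<dots> = (\<Sum>c\<in>C. prob {\<omega> \<in> space M. X \<omega> = c} * f c)"
    using ev by (simp add: mult.commute)
  finally show ?thesis .
qed

text \<open>Hoeffding's inequality for \<open>n\<close> independent variables in an interval of
  length 2, where the exponent becomes \<open>- 2 * (n * t)\<^sup>2 / (4 * n)\<close>.\<close>

lemma (in prob_space) empirical_moment_deviation:
  assumes indep: "indep_vars (\<lambda>_. count_space UNIV) Y {..<n}"
    and range: "\<And>j \<omega>. j < n \<Longrightarrow> \<omega> \<in> space M \<Longrightarrow> Y j \<omega> \<in> cube p"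
    and dist: "\<And>j \<sigma>. j < n \<Longrightarrow> prob {\<omega> \<in> space M. Y j \<omega> = \<sigma>} = \<mu> \<sigma>"
    and n: "0 < n" and t: "0 \<le> t"
  shows "prob {\<omega> \<in> space M. t \<le> \<bar>(\<Sum>j<n. sigK (Y j \<omega>) K) / real n - (\<Sum>\<sigma>\<in>cube p. \<mu> \<sigma> * sigK \<sigma> K)\<bar>}
    \<le> 2 * exp (- (real n * t\<^sup>2 / 2))"
proof -
  define e where "e = (\<Sum>\<sigma>\<in>cube p. \<mu> \<sigma> * sigK \<sigma> K)"
  have meas: "Y j \<in> measurable M (count_space UNIV)" if "j < n" for j
    using indep that by (auto simp: indep_vars_def)
  have mean: "expectation (\<lambda>\<omega>. sigK (Y j \<omega>) K) = e" if "j < n" for j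
    using expectation_finite_valued[of "cube p" "Y j" "\<lambda>\<sigma>. sigK \<sigma> K"] meas range dist that
    by (simp add: e_def)
  have ind: "indep_vars (\<lambda>_. borel) (\<lambda>j \<omega>. sigK (Y j \<omega>) K) {..<n}"
    by (rule indep_vars_compose2[OF indep]) simp
  have "prob {\<omega> \<in> space M. real n * t \<le> \<bar>(\<Sum>j<n. sigK (Y j \<omega>) K) - (\<Sum>j<n. expectation (\<lambda>\<omega>. sigK (Y j \<omega>) K))\<bar>}
      \<le> 2 * exp (- 2 * (real n * t)\<^sup>2 / (\<Sum>j<n. (1 - (- 1))\<^sup>2))"
  proof (rule Hoeffding_ineq.Hoeffding_ineq_abs_ge)
    show "Hoeffding_ineq M {..<n} (\<lambda>j \<omega>. sigK (Y j \<omega>) K) (\<lambda>_. - 1) (\<lambda>_. 1)"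
    proof (unfold_locales)
      show "AE \<omega> in M. sigK (Y j \<omega>) K \<in> {- 1..1}" if "j \<in> {..<n}" for j
      proof (rule AE_I2)
        fix \<omega> assume "\<omega> \<in> space M"
        then have "\<bar>sigK (Y j \<omega>) K\<bar> = 1" using that by (intro abs_sigK[of _ p] range) auto
        then show "sigK (Y j \<omega>) K \<in> {- 1..1}" by (auto simp: abs_if split: if_splits)
      qed
    qed (use ind in auto)
  qed (use n t in auto)
  also have "(\<Sum>j<n. expectation (\<lambda>\<omega>. sigK (Y j \<omega>) K)) = real n * e"
    by (simp add: mean)
  also have "- 2 * (real n * t)\<^sup>2 / (\<Sum>j<n. (1 - (- 1))\<^sup>2) = - (real n * t\<^sup>2 / 2)"
    using n by (simp add: power2_eq_square field_simps)
  also have "{\<omega> \<in> space M. real n * t \<le> \<bar>(\<Sum>j<n. sigK (Y j \<omega>) K) - real n * e\<bar>} =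
      {\<omega> \<in> space M. t \<le> \<bar>(\<Sum>j<n. sigK (Y j \<omega>) K) / real n - e\<bar>}"
  proof -
    have "real n * t \<le> \<bar>s - real n * e\<bar> \<longleftrightarrow> t \<le> \<bar>s / real n - e\<bar>" for s
    proof -
      have "s - real n * e = real n * (s / real n - e)" using n by (simp add: field_simps)
      then have "\<bar>s - real n * e\<bar> = real n * \<bar>s / real n - e\<bar>" by (simp add: abs_mult)
      then show ?thesis using n by simp
    qed
    then show ?thesis by simp
  qed
  finally show ?thesis by (simp add: e_def)
qed

section \<open>Union bound over the low-order moments\<close>

lemma card_small_subsets_le:
  assumes "finite A" "m \<le> card A" "A \<noteq> {}"
  shows "card {K. K \<subseteq> A \<and> card K \<le> m} \<le> (m + 1) * card A ^ m"
proof -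
  have "{K. K \<subseteq> A \<and> card K \<le> m} = (\<Union>k\<le>m. {K. K \<subseteq> A \<and> card K = k})" by auto
  also have "card \<dots> \<le> (\<Sum>k\<le>m. card {K. K \<subseteq> A \<and> card K = k})"
    by (rule card_UN_le) simp
  also have "\<dots> = (\<Sum>k\<le>m. card A choose k)"
    using assms(1) by (simp add: n_subsets)
  also have "\<dots> \<le> (\<Sum>k\<le>m. card A ^ m)"
  proof (rule sum_mono)
    fix k assume k: "k \<in> {..m}"
    have "card A choose k \<le> card A ^ k"
      using k assms(2) by (intro binomial_le_pow) auto
    also have "\<dots> \<le> card A ^ m"
      using k assms by (intro power_increasing) (auto simp: Suc_le_eq card_gt_0_iff)
    finally show "card A choose k \<le> card A ^ m" .
  qed
  finally show ?thesis by simp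
qed

text \<open>The sample size makes the Hoeffding exponent at least \<open>L\<close>. The first
  summand of \<open>L\<close> pays for the \<open>p ^ (d + 2)\<close> in the number of sets, the
  second for the remaining polynomial factor, the two sides of the deviation, and \<delta>.\<close>

lemma sample_size_union_bound:
  fixes p d n :: nat and \<gamma> \<epsilon> \<delta> :: real
  assumes p: "2 \<le> p" and dp: "d + 2 \<le> p" and \<gamma>: "0 < \<gamma>" and \<epsilon>: "0 < \<epsilon>" and \<delta>: "0 < \<delta>"
    and n: "2 ^ 7 * exp (8 * \<gamma>) * \<gamma>\<^sup>2 * (1 + \<gamma>)\<^sup>2
       * ((real d + 2) * ln (exp 1 * real p) + ln (2 * real p * (real d + 2) / \<delta>)) / \<epsilon> ^ 4 \<le> real n"
  defines "t \<equiv> \<epsilon>\<^sup>2 * exp (- 4 * \<gamma>) / (8 * \<gamma> * (1 + \<gamma>))"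
  shows "real (card {K. K \<subseteq> {..<p} \<and> card K \<le> d + 2 - d mod 2}) * (2 * exp (- (real n * t\<^sup>2 / 2))) \<le> \<delta>"
proof -
  define L where "L = (real d + 2) * ln (exp 1 * real p) + ln (2 * real p * (real d + 2) / \<delta>)"
  define B where "B = exp (4 * \<gamma>) * \<gamma> * (1 + \<gamma>) / \<epsilon>\<^sup>2"
  have B: "0 < B" using \<gamma> \<epsilon> by (simp add: B_def)
  have "exp (4 * \<gamma>) ^ 2 = exp (8 * \<gamma>)" by (simp add: exp_double[symmetric])
  moreover have "(\<epsilon>\<^sup>2)\<^sup>2 = \<epsilon> ^ 4" by (simp flip: power_mult)
  ultimately have "2 ^ 7 * exp (8 * \<gamma>) * \<gamma>\<^sup>2 * (1 + \<gamma>)\<^sup>2 * L / \<epsilon> ^ 4 = 2 ^ 7 * B\<^sup>2 * L"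
    unfolding B_def power_mult_distrib power_divide by simp
  with n have n': "128 * B\<^sup>2 * L \<le> real n" by (simp add: L_def)
  \<comment> \<open>This explains the constant \<open>2 ^ 7\<close> in \<open>n\<close>: the
    exponent has \<open>t\<^sup>2 / 2\<close>, and \<open>2 * 8\<^sup>2 = 128\<close>.\<close>
  have "t = 1 / (8 * B)" by (simp add: t_def B_def exp_minus field_simps)
  then have t2: "t\<^sup>2 / 2 = 1 / (128 * B\<^sup>2)" by (simp add: power_divide power_mult_distrib)
  have "L = 128 * B\<^sup>2 * L * (1 / (128 * B\<^sup>2))" using B by simp
  also have "\<dots> \<le> real n * (t\<^sup>2 / 2)" unfolding t2 using n' by (intro mult_right_mono) auto
  finally have "exp (- (real n * t\<^sup>2 / 2)) \<le> exp (- L)" by simp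
  also have "exp (- L) = \<delta> / (2 * real p * (real d + 2)) / (exp 1 * real p) ^ (d + 2)"
  proof -
    have "exp ((real d + 2) * ln (exp 1 * real p)) = (exp 1 * real p) ^ (d + 2)"
      using p exp_of_nat_mult[of "d + 2" "ln (exp 1 * real p)"] by (simp add: add.commute)
    then have "exp L = (exp 1 * real p) ^ (d + 2) * (2 * real p * (real d + 2) / \<delta>)"
      using p \<delta> unfolding L_def exp_add by simp
    then show ?thesis by (simp add: exp_minus divide_inverse mult_ac)
  qed
  finally have ex: "exp (- (real n * t\<^sup>2 / 2)) \<le>
      \<delta> / (2 * real p * (real d + 2)) / (exp 1 * real p) ^ (d + 2)" .
  have "card {K. K \<subseteq> {..<p} \<and> card K \<le> d + 2 - d mod 2} \<le> card {K. K \<subseteq> {..<p} \<and> card K \<le> d + 2}"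
    by (intro card_mono) (auto intro: finite_subset[OF _ finite_Collect_subsets[of "{..<p}"]])
  also have "\<dots> \<le> (d + 2 + 1) * p ^ (d + 2)"
    using card_small_subsets_le[of "{..<p}" "d + 2"] dp p by (simp add: lessThan_empty_iff)
  also have "\<dots> \<le> (p * (d + 2)) * p ^ (d + 2)"
  proof (rule mult_right_mono)
    have "d + 2 + 1 \<le> 2 * (d + 2)" by simp
    also have "\<dots> \<le> p * (d + 2)" using p by (rule mult_right_mono) simp
    finally show "d + 2 + 1 \<le> p * (d + 2)" .
  qed simp
  finally have "card {K. K \<subseteq> {..<p} \<and> card K \<le> d + 2 - d mod 2} \<le> (p * (d + 2)) * p ^ (d + 2)" .
  then have "real (card {K. K \<subseteq> {..<p} \<and> card K \<le> d + 2 - d mod 2}) \<le> real ((p * (d + 2)) * p ^ (d + 2))"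
    by (simp only: of_nat_le_iff)
  also have "\<dots> = real p * (real d + 2) * real p ^ (d + 2)" by (simp add: distrib_left)
  also have "\<dots> \<le> real p * (real d + 2) * (exp 1 * real p) ^ (d + 2)"
  proof (intro mult_left_mono power_mono)
    show "real p \<le> exp 1 * real p" using mult_right_mono[of 1 "exp 1" "real p"] by simp
  qed auto
  finally have c: "real (card {K. K \<subseteq> {..<p} \<and> card K \<le> d + 2 - d mod 2}) \<le>
      real p * (real d + 2) * (exp 1 * real p) ^ (d + 2)" .
  have "real (card {K. K \<subseteq> {..<p} \<and> card K \<le> d + 2 - d mod 2}) * (2 * exp (- (real n * t\<^sup>2 / 2))) \<le>
      (real p * (real d + 2) * (exp 1 * real p) ^ (d + 2)) *
      (2 * (\<delta> / (2 * real p * (real d + 2)) / (exp 1 * real p) ^ (d + 2)))"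
    using c ex by (intro mult_mono) auto
  also have "\<dots> = \<delta>"
  proof -
    have "a * P * (2 * (\<delta> / (2 * a) / P)) = \<delta>" if "0 < a" "0 < P" for a P :: real
      using that by simp
    from this[of "real p * (real d + 2)" "(exp 1 * real p) ^ (d + 2)"]
    show ?thesis using p by (simp add: mult.assoc)
  qed
  finally show ?thesis .
qed

theorem theorem1:
  fixes p :: nat and th :: "nat \<Rightarrow> nat \<Rightarrow> real" and h :: "nat \<Rightarrow> real"
    and \<gamma> \<epsilon> \<delta> :: real and d T n :: nat and u :: nat
    and M :: "'a measure" and X :: "nat set \<Rightarrow> nat \<Rightarrow> 'a \<Rightarrow> (nat \<Rightarrow> real)"
  assumes p2: "2 \<le> p"
    and gam: "0 < \<gamma>"
    and sym: "\<forall>v<p. \<forall>w<p. th v w = th w v"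
    and width: "l1_width_le p th h \<gamma>"
    and eps: "0 < \<epsilon>" "\<epsilon> \<le> 4 * \<gamma>"
    and del: "0 < \<delta>" "\<delta> < 1"
    and d_def: "int d = \<lceil>(3 * \<gamma> + ln (16 * \<gamma> * (1 + \<gamma>) / \<epsilon>\<^sup>2))
                   / lambertW (3 / exp 1 + ln (16 * \<gamma> * (1 + \<gamma>) / \<epsilon>\<^sup>2) / (\<gamma> * exp 1))\<rceil> - 1"
    and T_def: "int T = \<lceil>576 * real p * \<gamma>\<^sup>2 * exp (8 * \<gamma>) * (1 + \<gamma>)\<^sup>2 / \<epsilon> ^ 4\<rceil>"
    and n_def: "int n = \<lceil>2 ^ 7 * exp (8 * \<gamma>) * \<gamma>\<^sup>2 * (1 + \<gamma>)\<^sup>2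
                   * ((real d + 2) * ln (exp 1 * real p) + ln (2 * real p * (real d + 2) / \<delta>))
                   / \<epsilon> ^ 4\<rceil>"
    and dp: "d + 2 \<le> p"
    and u: "u < p"
    and M: "prob_space M"
    and samples_range: "\<forall>K. K \<subseteq> {..<p} \<and> card K \<le> d + 2 - d mod 2 \<longrightarrow>
           (\<forall>j<n. \<forall>\<omega>\<in>space M. X K j \<omega> \<in> cube p)"
    and samples_meas: "\<forall>K. K \<subseteq> {..<p} \<and> card K \<le> d + 2 - d mod 2 \<longrightarrow>
           (\<forall>j<n. X K j \<in> measurable M (count_space UNIV))"
    and samples_dist: "\<forall>K. K \<subseteq> {..<p} \<and> card K \<le> d + 2 - d mod 2 \<longrightarrow>
           (\<forall>j<n. \<forall>\<sigma>. measure M {\<omega>\<in>space M. X K j \<omega> = \<sigma>} = ising_prob p th h \<sigma>)"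
    and samples_indep: "\<forall>K. K \<subseteq> {..<p} \<and> card K \<le> d + 2 - d mod 2 \<longrightarrow>
           prob_space.indep_vars M (\<lambda>_. count_space UNIV) (X K) {..<n}"
  shows "measure M {\<omega>\<in>space M.
            (let mhat = (\<lambda>K. (\<Sum>j<n. sigK (X K j \<omega>) K) / real n);
                 \<theta>hat = algorithm1 p d \<gamma> (2 * \<gamma> * exp (- \<gamma>) / (3 * sqrt (real p * real T))) T mhat u
             in \<forall>v<p. v \<noteq> u \<longrightarrow> \<bar>\<theta>hat v - th u v\<bar> \<le> \<epsilon>)} \<ge> 1 - \<delta>"
proof -
  interpret prob_space M by (rule M)
  define Ks where "Ks = {K. K \<subseteq> {..<p} \<and> card K \<le> d + 2 - d mod 2}"
  define t where "t = \<epsilon>\<^sup>2 * exp (- 4 * \<gamma>) / (8 * \<gamma> * (1 + \<gamma>))"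
  define mhat where "mhat \<omega> K = (\<Sum>j<n. sigK (X K j \<omega>) K) / real n" for \<omega> K
  define mom where "mom K = (\<Sum>\<sigma>\<in>cube p. ising_prob p th h \<sigma> * sigK \<sigma> K)" for K
  define \<eta> where "\<eta> = 2 * \<gamma> * exp (- \<gamma>) / (3 * sqrt (real p * real T))"
  define Q where "Q \<omega> \<longleftrightarrow> (\<forall>v<p. v \<noteq> u \<longrightarrow> \<bar>algorithm1 p d \<gamma> \<eta> T (mhat \<omega>) u v - th u v\<bar> \<le> \<epsilon>)" for \<omega>
  define bad where "bad K = {\<omega> \<in> space M. t \<le> \<bar>mhat \<omega> K - mom K\<bar>}" for K
  have finKs: "finite Ks" unfolding Ks_def by (rule finite_subset[of _ "Pow {..<p}"]) auto
  have t: "0 < t" using gam eps by (simp add: t_def)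
  \<comment> \<open>\<open>d\<close> is a ceiling minus one, so the ceiling is \<open>Suc d\<close>,
    the first degree omitted by the truncation.\<close>
  have d: "(3 * \<gamma> + ln (16 * \<gamma> * (1 + \<gamma>) / \<epsilon>\<^sup>2)) /
       lambertW (3 / exp 1 + ln (16 * \<gamma> * (1 + \<gamma>) / \<epsilon>\<^sup>2) / (\<gamma> * exp 1)) \<le> real (Suc d)"
    using d_def by linarith
  have T: "576 * real p * \<gamma>\<^sup>2 * exp (8 * \<gamma>) * (1 + \<gamma>)\<^sup>2 / \<epsilon> ^ 4 \<le> real T"
    using T_def by linarith
  define N where "N = 2 ^ 7 * exp (8 * \<gamma>) * \<gamma>\<^sup>2 * (1 + \<gamma>)\<^sup>2
       * ((real d + 2) * ln (exp 1 * real p) + ln (2 * real p * (real d + 2) / \<delta>)) / \<epsilon> ^ 4"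
  have N: "N \<le> real n" using n_def unfolding N_def by linarith
  \<comment> \<open>Positivity makes the empirical averages genuine averages; both logarithms in
    \<open>n\<close> are checked for sign.\<close>
  have n0: "0 < n"
  proof -
    have "1 < exp 1 * real p" using p2 mult_strict_mono[of 1 "exp 1" 1 "real p"] by simp
    then have 1: "0 < (real d + 2) * ln (exp 1 * real p)" by (intro mult_pos_pos) auto
    have "\<delta> \<le> 2 * real p * (real d + 2)"
      using del p2 mult_mono[of 1 "2 * real p" 1 "real d + 2"] by simp
    then have "0 \<le> ln (2 * real p * (real d + 2) / \<delta>)" using del p2 by (simp add: pos_le_divide_eq)
    with 1 have "0 < (real d + 2) * ln (exp 1 * real p) + ln (2 * real p * (real d + 2) / \<delta>)"
      by (rule add_pos_nonneg)
    then have "0 < N" unfolding N_def using gam eps by (intro divide_pos_pos mult_pos_pos) auto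
    with N show ?thesis by simp
  qed
  have smp: "indep_vars (\<lambda>_. count_space UNIV) (X K) {..<n}"
    "\<And>j. j < n \<Longrightarrow> X K j \<in> measurable M (count_space UNIV)"
    "\<And>j \<omega>. j < n \<Longrightarrow> \<omega> \<in> space M \<Longrightarrow> X K j \<omega> \<in> cube p"
    "\<And>j \<sigma>. j < n \<Longrightarrow> prob {\<omega> \<in> space M. X K j \<omega> = \<sigma>} = ising_prob p th h \<sigma>"
    if "K \<in> Ks" for K
    using that samples_indep samples_meas samples_range samples_dist by (auto simp: Ks_def)
  have mhat_cong: "mhat \<omega> K = mhat \<omega>' K" if "\<And>j. j < n \<Longrightarrow> X K j \<omega> = X K j \<omega>'" for \<omega> \<omega>' K
    using that by (simp add: mhat_def)
  \<comment> \<open>The output depends only on the first \<open>n\<close> samples of each set in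
    \<open>Ks\<close>, that is, on finitely many variables with values in the finite cube.\<close>
  have Qev: "{\<omega> \<in> space M. Q \<omega>} \<in> events"
  proof (rule sets_determined_by_finitely_many[where I = "Ks \<times> {..<n}" and C = "cube p" and X = "\<lambda>(K, j). X K j"])
    fix \<omega> \<omega>'
    assume eq: "\<And>i. i \<in> Ks \<times> {..<n} \<Longrightarrow> (case i of (K, j) \<Rightarrow> X K j) \<omega> = (case i of (K, j) \<Rightarrow> X K j) \<omega>'"
      and Q: "Q \<omega>"
    have "mhat \<omega> K = mhat \<omega>' K" if "K \<in> Ks" for K
      by (rule mhat_cong) (use eq[of "(K, _)"] that in auto)
    then have "algorithm1 p d \<gamma> \<eta> T (mhat \<omega>) u = algorithm1 p d \<gamma> \<eta> T (mhat \<omega>') u"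
      by (intro algorithm1_cong[OF u]) (auto simp: Ks_def)
    with Q show "Q \<omega>'" by (simp add: Q_def)
  qed (use finKs smp in auto)
  have bad_ev: "bad K \<in> events" if K: "K \<in> Ks" for K
    unfolding bad_def
  proof (rule sets_determined_by_finitely_many[where I = "{..<n}" and C = "cube p" and X = "X K"])
    fix \<omega> \<omega>'
    assume "\<And>j. j \<in> {..<n} \<Longrightarrow> X K j \<omega> = X K j \<omega>'" "t \<le> \<bar>mhat \<omega> K - mom K\<bar>"
    then show "t \<le> \<bar>mhat \<omega>' K - mom K\<bar>" using mhat_cong[of K \<omega> \<omega>'] by simp
  qed (use smp[OF K] in auto)
  have bad_prob: "prob (bad K) \<le> 2 * exp (- (real n * t\<^sup>2 / 2))" if K: "K \<in> Ks" for K
    using empirical_moment_deviation[OF smp(1,3,4)[OF K] n0, of t] t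
    by (simp add: bad_def mhat_def mom_def)
  \<comment> \<open>The union bound works for any joint law of the sample families of different
    sets, so these may share samples or not.\<close>
  have "prob (\<Union>K\<in>Ks. bad K) \<le> (\<Sum>K\<in>Ks. prob (bad K))"
    using finKs bad_ev by (intro finite_measure_subadditive_finite) auto
  also have "\<dots> \<le> (\<Sum>K\<in>Ks. 2 * exp (- (real n * t\<^sup>2 / 2)))"
    by (intro sum_mono bad_prob)
  also have "\<dots> = real (card Ks) * (2 * exp (- (real n * t\<^sup>2 / 2)))" by simp
  also have "\<dots> \<le> \<delta>"
    unfolding Ks_def t_def
    by (rule sample_size_union_bound[OF p2 dp gam eps(1) del(1)]) (use N in \<open>simp add: N_def\<close>)
  finally have bad_le: "prob (\<Union>K\<in>Ks. bad K) \<le> \<delta>" .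
  have good: "space M - (\<Union>K\<in>Ks. bad K) \<subseteq> {\<omega> \<in> space M. Q \<omega>}"
  proof
    fix \<omega> assume \<omega>: "\<omega> \<in> space M - (\<Union>K\<in>Ks. bad K)"
    have "\<bar>algorithm1 p d \<gamma> \<eta> T (mhat \<omega>) u v - th u v\<bar> \<le> \<epsilon>" if "v < p" "v \<noteq> u" for v
      unfolding \<eta>_def
    proof (rule algorithm1_accurate[OF _ gam eps sym width u that d T])
      fix K assume "K \<subseteq> {..<p}" "card K \<le> d + 2 - d mod 2"
      then have K: "K \<in> Ks" by (simp add: Ks_def)
      have "\<bar>\<Sum>j<n. sigK (X K j \<omega>) K\<bar> \<le> (\<Sum>j<n. 1)"
        using smp(3)[OF K] \<omega> by (intro order.trans[OF sum_abs] sum_mono) (simp add: abs_sigK[of _ p])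
      then show "\<bar>mhat \<omega> K\<bar> \<le> 1" using n0 by (simp add: mhat_def)
      show "\<bar>mhat \<omega> K - (\<Sum>\<sigma>\<in>cube p. ising_prob p th h \<sigma> * sigK \<sigma> K)\<bar>
          \<le> \<epsilon>\<^sup>2 * exp (- 4 * \<gamma>) / (8 * \<gamma> * (1 + \<gamma>))"
        using \<omega> K by (auto simp: bad_def mom_def t_def)
    qed (use p2 in simp)
    then show "\<omega> \<in> {\<omega> \<in> space M. Q \<omega>}" using \<omega> by (simp add: Q_def)
  qed
  have "1 - \<delta> \<le> 1 - prob (\<Union>K\<in>Ks. bad K)" using bad_le by simp
  also have "\<dots> = prob (space M - (\<Union>K\<in>Ks. bad K))"
    by (rule prob_compl[symmetric]) (use finKs bad_ev in auto)
  also have "\<dots> \<le> prob {\<omega> \<in> space M. Q \<omega>}"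
    by (rule finite_measure_mono[OF good Qev])
  finally show ?thesis
    by (simp add: Q_def mhat_def[abs_def] \<eta>_def Let_def)
qed

end
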